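(* Consider the networked system $x(t+1)=(A+BQC)x(t)+BRu(t)$, $y(t)=SCx(t)$ described in the context, and let $G_i(z):=C_i(zI-A_i)^{-1}B_i$ for $i\in\{1,\dots,N\}$. If the topology of this system is identifiable, then $$\operatorname{cker}\left(G_i^\top(z)\otimes G_j(z)\right)=\{0\}\quad\text{for all } i,j\in\{1,2,\dots,N\}.\qquad( * )$$ In addition, suppose that $S$ has full column rank and $R$ has full row rank. Then the topology of the system is identifiable if and only if $( * )$ holds.
   Context: Network model. Let $N\ge 1$. For $i\in\mathcal V:=\{1,2,\dots,N\}$, let $A_i\in\mathbb R^{n_i\times n_i}$, $B_i\in\mathbb R^{n_i\times m_i}$, $C_i\in\mathbb R^{p_i\times n_i}$ define the discrete-time node system $x_i(t+1)=A_ix_i(t)+B_iv_i(t)$, $w_i(t)=C_ix_i(t)$. The nodes are coupled by $v_i(t)=\sum_{j=1}^N Q_{ij}w_j(t)+R_iu(t)$ with external input $u(t)\in\mathbb R^m$, and the external output is $y(t)=\sum_{i=1}^N S_iw_i(t)\in\mathbb R^p$, where $Q_{ij}\in\mathbb R^{m_i\times p_j}$, $R_i\in\mathbb R^{m_i\times m}$, $S_i\in\mathbb R^{p\times p_i}$. Let $A,B,C$ be the block diagonal matrices with diagonal blocks $A_i$, $B_i$, $C_i$ ($i=1,\dots,N$), respectively; let $Q=(Q_{ij})$ be the block matrix with blocks $Q_{ij}$ (the interconnection matrix), let $R$ be the matrix obtained by stacking $R_1,\dots,R_N$ on top of each other, and $S=\begin{pmatrix}S_1&\cdots&S_N\end{pmatrix}$.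 With $n=\sum_i n_i$ and $x(t)\in\mathbb R^n$ the stacked state, the network is $x(t+1)=(A+BQC)x(t)+BRu(t)$, $y(t)=SCx(t)$, $t=0,1,2,\dots$. The matrices $A,B,C,R,S$ are fixed and known. Identifiability. Let $y_{u,x_0,Q}(\cdot)$ denote the output of the network for input $u(\cdot)$, initial condition $x(0)=x_0$ and interconnection matrix $Q$. Two real interconnection matrices $Q,\bar Q$ (of the same size) are indistinguishable if there exist $x_0,\bar x_0\in\mathbb R^n$ such that $y_{u,x_0,Q}(\cdot)=y_{u,\bar x_0,\bar Q}(\cdot)$ for all input functions $u$; otherwise they are distinguishable. The topology of the network with interconnection matrix $Q$ is identifiable if $Q$ and $\bar Q$ are distinguishable for all real $\bar Q\neq Q$. Other notation. $\otimes$ is the Kronecker product. For a rational matrix $M(z)$ with $k$ columns, its constant kernel is $\operatorname{cker}M(z):=\{w\in\mathbb R^k\mid M(z)w=0\}$. *)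

theory Defs
  imports
    "HOL-Computational_Algebra.Polynomial_Factorial"
    "Jordan_Normal_Form.DL_Rank"
    "Jordan_Normal_Form.Gauss_Jordan_Elimination"
begin

definition append_cols :: "'a::zero mat \<Rightarrow> 'a mat \<Rightarrow> 'a mat" where
  "append_cols A B = four_block_mat A B (0\<^sub>m 0 (dim_col A)) (0\<^sub>m 0 (dim_col B))"

(* The explicit dimension only fixes the shape of the empty concatenation. *)

definition vcat :: "nat \<Rightarrow> 'a::zero mat list \<Rightarrow> 'a mat" where
  "vcat nc Ms = foldr append_rows Ms (0\<^sub>m 0 nc)"

definition hcat :: "nat \<Rightarrow> 'a::zero mat list \<Rightarrow> 'a mat" where
  "hcat nr Ms = foldr append_cols Ms (0\<^sub>m nr 0)"

(* Families are indexed from 0, so the nodes 1, ..., N of the network become 0, ..., N - 1. *)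

definition block_diag :: "nat \<Rightarrow> (nat \<Rightarrow> 'a::zero mat) \<Rightarrow> 'a mat" where
  "block_diag N M = diag_block_mat (map M [0..<N])"

definition block_col :: "nat \<Rightarrow> nat \<Rightarrow> (nat \<Rightarrow> 'a::zero mat) \<Rightarrow> 'a mat" where
  "block_col nc N M = vcat nc (map M [0..<N])"

definition block_row :: "nat \<Rightarrow> nat \<Rightarrow> (nat \<Rightarrow> 'a::zero mat) \<Rightarrow> 'a mat" where
  "block_row nr N M = hcat nr (map M [0..<N])"

(* Block (i, j) has size r i x c j. *)

definition block_mat ::
  "nat \<Rightarrow> (nat \<Rightarrow> nat) \<Rightarrow> (nat \<Rightarrow> nat) \<Rightarrow> (nat \<Rightarrow> nat \<Rightarrow> 'a::zero mat) \<Rightarrow> 'a mat" where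
  "block_mat N r c M = block_col (\<Sum>j<N. c j) N (\<lambda>i. block_row (r i) N (M i))"

definition kronecker :: "'a::times mat \<Rightarrow> 'a mat \<Rightarrow> 'a mat" where
  "kronecker A B = mat (dim_row A * dim_row B) (dim_col A * dim_col B)
     (\<lambda>(i, j). A $$ (i div dim_row B, j div dim_col B) * B $$ (i mod dim_row B, j mod dim_col B))"

definition full_col_rank :: "real mat \<Rightarrow> bool" where
  "full_col_rank M \<longleftrightarrow> vec_space.rank (dim_row M) M = dim_col M"

definition full_row_rank :: "real mat \<Rightarrow> bool" where
  "full_row_rank M \<longleftrightarrow> vec_space.rank (dim_row M) M = dim_row M"


(* Real rational functions in z are the fractions of real polynomials. *)

type_synonym ratfun = "real poly fract"

definition rf_const :: "real \<Rightarrow> ratfun" where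
  "rf_const a = to_fract [:a:]"

definition rf_z :: ratfun where
  "rf_z = to_fract [:0, 1:]"

(* z I - A has a monic, hence nonzero, determinant, so mat_inverse never returns None here. *)

definition transfer_mat :: "real mat \<Rightarrow> real mat \<Rightarrow> real mat \<Rightarrow> ratfun mat" where
  "transfer_mat A B C =
     map_mat rf_const C
     * the (mat_inverse (rf_z \<cdot>\<^sub>m 1\<^sub>m (dim_row A) - map_mat rf_const A))
     * map_mat rf_const B"

definition cker :: "ratfun mat \<Rightarrow> real vec set" where
  "cker M = {w \<in> carrier_vec (dim_col M). M *\<^sub>v map_vec rf_const w = 0\<^sub>v (dim_row M)}"


(* In the following, A, B, C, R, S, Q are the aggregated block matrices. *)

primrec net_state ::
  "real mat \<Rightarrow> real mat \<Rightarrow> real mat \<Rightarrow> real mat \<Rightarrow> (nat \<Rightarrow> real vec) \<Rightarrow> real vec \<Rightarrow> real mat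
    \<Rightarrow> nat \<Rightarrow> real vec" where
  "net_state A B C R u x0 Q 0 = x0"
| "net_state A B C R u x0 Q (Suc t) =
     (A + B * Q * C) *\<^sub>v net_state A B C R u x0 Q t + (B * R) *\<^sub>v u t"

definition net_output ::
  "real mat \<Rightarrow> real mat \<Rightarrow> real mat \<Rightarrow> real mat \<Rightarrow> real mat \<Rightarrow> (nat \<Rightarrow> real vec) \<Rightarrow> real vec \<Rightarrow> real mat
    \<Rightarrow> nat \<Rightarrow> real vec" where
  "net_output A B C R S u x0 Q t = (S * C) *\<^sub>v net_state A B C R u x0 Q t"

definition indistinguishable ::
  "real mat \<Rightarrow> real mat \<Rightarrow> real mat \<Rightarrow> real mat \<Rightarrow> real mat \<Rightarrow> real mat \<Rightarrow> real mat \<Rightarrow> bool" where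
  "indistinguishable A B C R S Q Q' \<longleftrightarrow>
     (\<exists>x0 \<in> carrier_vec (dim_row A). \<exists>x0' \<in> carrier_vec (dim_row A).
        \<forall>u. (\<forall>t. u t \<in> carrier_vec (dim_col R)) \<longrightarrow>
            net_output A B C R S u x0 Q = net_output A B C R S u x0' Q')"

definition topology_identifiable ::
  "real mat \<Rightarrow> real mat \<Rightarrow> real mat \<Rightarrow> real mat \<Rightarrow> real mat \<Rightarrow> real mat \<Rightarrow> bool" where
  "topology_identifiable A B C R S Q \<longleftrightarrow>
     (\<forall>Q' \<in> carrier_mat (dim_row Q) (dim_col Q).
        Q' \<noteq> Q \<longrightarrow> \<not> indistinguishable A B C R S Q Q')"

end

theory Submission
  imports
    Defs
    "HOL-Computational_Algebra.Formal_Laurent_Series"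
    "Jordan_Normal_Form.Char_Poly"
begin

text \<open>
  Two interconnection matrices \<open>Q\<close> and \<open>Q'\<close> are compared through
  \<open>H(Q) = C (z I - A - B Q C)\<inverse> B\<close>, the transfer matrix of the network before the external
  gains \<open>R\<close> and \<open>S\<close> are applied. For the decoupled nodes it is \<open>H(0) = G = C (z I - A)\<inverse> B\<close>. The
  resolvent identity gives \<open>H(Q) - H(Q') = H(Q) (Q - Q') H(Q')\<close>. Its special case \<open>Q' = 0\<close> says
  \<open>H(Q) = (I + H(Q) Q) G\<close>, and the same identity with the roles of \<open>Q\<close> and \<open>0\<close> exchanged says
  \<open>G = (I - G Q) H(Q)\<close>; both have mirror images with the factor on the right. Hence \<open>H(Q) = H(Q')\<close> if
  and only if \<open>G (Q - Q') G = 0\<close> (\<open>transfer_mat_feedback_eq_iff\<close>): the condition has become linear in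
  \<open>Q - Q'\<close>.

  As \<open>G\<close> is block diagonal with blocks \<open>G\<^sub>i\<close>, the equation \<open>G D G = 0\<close> splits into
  \<open>G\<^sub>j D\<^sub>j\<^sub>i G\<^sub>i = 0\<close> for all pairs of nodes, and stacking the columns of \<open>D\<^sub>j\<^sub>i\<close> turns this into
  membership in the constant kernel of \<open>G\<^sub>i\<^sup>T \<otimes> G\<^sub>j\<close> (\<open>cker_kronecker_trivial_iff\<close>). So the kernel
  condition says exactly that \<open>H\<close> is injective on real interconnection matrices.

  The time domain enters through Markov parameters. Comparing the responses to an impulse and to the
  zero input shows that \<open>Q\<close> and \<open>Q'\<close> are indistinguishable if and only if
  \<open>S C T\<^sup>k B R = S C T'\<^sup>k B R\<close> for all \<open>k\<close>, where \<open>T = A + B Q C\<close> and \<open>T' = A + B Q' C\<close>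
  (\<open>indistinguishable_iff_markov_eq\<close>). On the other hand \<open>C T\<^sup>k B\<close> are the coefficients of \<open>H(Q)\<close> in its
  expansion at \<open>z = \<infinity>\<close>, so that \<open>H(Q) = H(Q')\<close> means \<open>C T\<^sup>k B = C T'\<^sup>k B\<close> for all \<open>k\<close>
  (\<open>transfer_mat_eq_iff_markov_eq\<close>). This always implies indistinguishability, which gives the
  necessity of the kernel condition; if \<open>S\<close> has full column rank and \<open>R\<close> full row rank, both can be
  cancelled and the implication reverses.
\<close>

section \<open>Matrix identities\<close>

text \<open>
  A form of associativity whose side conditions mention only the factors: unlike the carrier version
  it leaves no dimensions to be guessed, so the simplifier can reassociate long products with it.
\<close>

lemma assoc_mult_mat_dim:
  fixes X :: "'a::semiring_0 mat"
  assumes "dim_col X = dim_row Y" "dim_col Y = dim_row W"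
  shows "X * Y * W = X * (Y * W)"
  using assms by (intro assoc_mult_mat[of _ "dim_row X" "dim_col X" _ "dim_col Y" _ "dim_col W"]) auto

lemma add_diff_cancel_mat:
  fixes X :: "'a::comm_ring_1 mat"
  assumes "X \<in> carrier_mat a b" "Y \<in> carrier_mat a b"
  shows "X + Y - Y = X"
  using assms by (intro eq_matI) auto

lemma pow_mat_Suc_left:
  assumes "T \<in> carrier_mat n n"
  shows "T ^\<^sub>m Suc k = T * T ^\<^sub>m k"
proof (induction k)
  case (Suc k)
  then show ?case
    using assms by (simp add: assoc_mult_mat[of _ n n _ n _ n])
qed (use assms in simp)

lemma eq_mat_if_mult_vec_eq:
  fixes X Y :: "'a::semiring_1 mat"
  assumes "X \<in> carrier_mat r c" "Y \<in> carrier_mat r c"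
    and "\<And>v. v \<in> carrier_vec c \<Longrightarrow> X *\<^sub>v v = Y *\<^sub>v v"
  shows "X = Y"
proof (rule eq_matI)
  fix i j assume ij: "i < dim_row Y" "j < dim_col Y"
  have "(X *\<^sub>v unit_vec c j) $ i = (Y *\<^sub>v unit_vec c j) $ i"
    using assms(3) by simp
  then show "X $$ (i, j) = Y $$ (i, j)"
    using assms(1,2) ij by simp
qed (use assms in auto)

lemma mult_mat_zero_vec:
  fixes X :: "'a::semiring_0 mat"
  assumes "X \<in> carrier_mat r c"
  shows "X *\<^sub>v 0\<^sub>v c = 0\<^sub>v r"
  using assms by (intro eq_vecI) (auto simp: scalar_prod_def)

lemma vec_add_left_imp_eq:
  fixes a x y :: "'a::cancel_semigroup_add vec"
  assumes "a + x = a + y" "x \<in> carrier_vec n" "y \<in> carrier_vec n"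
  shows "x = y"
proof (rule eq_vecI)
  fix i assume "i < dim_vec y"
  then show "x $ i = y $ i"
    using arg_cong[OF assms(1), of "\<lambda>v. vec_index v i"] assms(2,3) by simp
qed (use assms in auto)

section \<open>Laurent expansion of rational functions at infinity\<close>

text \<open>
  The local parameter at infinity is \<open>X = 1 / z\<close>, so a polynomial in \<open>z\<close> becomes a polynomial in
  \<open>X\<inverse>\<close>.
\<close>

definition poly_at_infinity :: "'a::comm_ring_1 poly \<Rightarrow> 'a fls" where
  "poly_at_infinity p = poly (map_poly fls_const p) fls_X_inv"

interpretation fls_const_hom: comm_ring_hom "fls_const :: 'a::comm_ring_1 \<Rightarrow> 'a fls"
  by unfold_locales (simp_all only: fls_const_0 fls_const_1 fls_plus_const fls_const_mult_const)

interpretation fls_const_poly_hom: map_poly_comm_ring_hom "fls_const :: 'a::comm_ring_1 \<Rightarrow> 'a fls" ..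

lemma poly_at_infinity_add: "poly_at_infinity (p + q) = poly_at_infinity p + poly_at_infinity q"
  by (simp add: poly_at_infinity_def hom_distribs)

lemma poly_at_infinity_mult: "poly_at_infinity (p * q) = poly_at_infinity p * poly_at_infinity q"
  by (simp add: poly_at_infinity_def hom_distribs)

lemma poly_at_infinity_0 [simp]: "poly_at_infinity 0 = 0"
  by (simp add: poly_at_infinity_def)

lemma poly_at_infinity_1 [simp]: "poly_at_infinity 1 = 1"
  by (simp add: poly_at_infinity_def)

lemma poly_at_infinity_pCons:
  "poly_at_infinity (pCons a p) = fls_const a + fls_X_inv * poly_at_infinity p"
  by (simp add: poly_at_infinity_def hom_distribs)

lemma poly_at_infinity_nth:
  "fls_nth (poly_at_infinity p) n = (if n \<le> 0 then coeff p (nat (- n)) else 0)"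
proof (induction p arbitrary: n)
  case (pCons a p)
  have "nat (- n) = Suc (nat (- (n + 1)))" if "n < 0"
    using that by simp
  then show ?case
    using pCons.IH[of "n + 1"]
    by (auto simp: poly_at_infinity_pCons fls_X_inv_times_conv_shift coeff_pCons split: nat.split)
qed simp

lemma poly_at_infinity_eq_0_iff [simp]: "poly_at_infinity p = 0 \<longleftrightarrow> p = 0"
proof
  assume "poly_at_infinity p = 0"
  then have "fls_nth (poly_at_infinity p) (- int k) = 0" for k
    by simp
  then show "p = 0"
    by (intro poly_eqI) (simp add: poly_at_infinity_nth)
qed simp

text \<open>
  The expansion of a fraction is the quotient of the expansions of its numerator and denominator;
  any representative will do, as the following lemma shows. It embeds the rational functions into a
  field whose elements have coefficients, which makes Markov parameters accessible.
\<close>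

definition laurent_at_infinity :: "ratfun \<Rightarrow> real fls" where
  "laurent_at_infinity f =
     (case SOME (a, b). b \<noteq> 0 \<and> f = Fract a b of (a, b) \<Rightarrow> poly_at_infinity a / poly_at_infinity b)"

lemma laurent_at_infinity_Fract:
  assumes "b \<noteq> 0"
  shows "laurent_at_infinity (Fract a b) = poly_at_infinity a / poly_at_infinity b"
proof -
  let ?P = "\<lambda>(c, d). d \<noteq> 0 \<and> Fract a b = Fract c d"
  obtain c d where cd: "(SOME x. ?P x) = (c, d)"
    by fastforce
  have "?P (SOME x. ?P x)"
    by (rule someI[of ?P "(a, b)"]) (simp add: assms)
  then have "d \<noteq> 0" "Fract a b = Fract c d"
    unfolding cd by auto
  then have "a * d = c * b"
    using assms by (simp add: eq_fract)
  then have "poly_at_infinity a * poly_at_infinity d = poly_at_infinity c * poly_at_infinity b"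
    by (metis poly_at_infinity_mult)
  then show ?thesis
    using assms \<open>d \<noteq> 0\<close> by (simp add: laurent_at_infinity_def cd frac_eq_eq)
qed

lemma laurent_at_infinity_rf_const: "laurent_at_infinity (rf_const a) = fls_const a"
  by (simp add: rf_const_def to_fract_def laurent_at_infinity_Fract poly_at_infinity_pCons)

lemma laurent_at_infinity_rf_z: "laurent_at_infinity rf_z = fls_X_inv"
  by (simp add: rf_z_def to_fract_def laurent_at_infinity_Fract poly_at_infinity_pCons)

lemma laurent_at_infinity_add: "laurent_at_infinity (f + g) = laurent_at_infinity f + laurent_at_infinity g"
  by (cases f; cases g)
    (simp add: laurent_at_infinity_Fract poly_at_infinity_add poly_at_infinity_mult add_frac_eq)

lemma laurent_at_infinity_mult: "laurent_at_infinity (f * g) = laurent_at_infinity f * laurent_at_infinity g"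
  by (cases f; cases g) (simp add: laurent_at_infinity_Fract poly_at_infinity_mult)

lemma laurent_at_infinity_1: "laurent_at_infinity 1 = 1"
  by (simp add: One_fract_def laurent_at_infinity_Fract)

lemma laurent_at_infinity_eq_0_iff: "laurent_at_infinity f = 0 \<longleftrightarrow> f = 0"
  by (cases f) (auto simp: laurent_at_infinity_Fract eq_fract Zero_fract_def)

interpretation laurent_at_infinity_hom: inj_comm_ring_hom laurent_at_infinity
  by unfold_locales
    (auto simp: laurent_at_infinity_add laurent_at_infinity_mult laurent_at_infinity_1 laurent_at_infinity_eq_0_iff)

interpretation rf_const_hom: inj_comm_ring_hom rf_const
  by unfold_locales (auto simp: rf_const_def simp flip: to_fract_add to_fract_mult one_pCons)

section \<open>Resolvents and Markov parameters\<close>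

definition resolvent :: "real mat \<Rightarrow> ratfun mat" where
  "resolvent T = the (mat_inverse (rf_z \<cdot>\<^sub>m 1\<^sub>m (dim_row T) - map_mat rf_const T))"

lemma transfer_mat_resolvent:
  "transfer_mat A B C = map_mat rf_const C * resolvent A * map_mat rf_const B"
  by (simp add: transfer_mat_def resolvent_def)

text \<open>
  The determinant of \<open>z I - T\<close> is the characteristic polynomial, seen as a rational function; it is
  monic and therefore nonzero.
\<close>

lemma resolvent_inverse:
  assumes T: "T \<in> carrier_mat n n"
  defines "M \<equiv> rf_z \<cdot>\<^sub>m 1\<^sub>m n - map_mat rf_const T"
  shows "resolvent T \<in> carrier_mat n n" "M * resolvent T = 1\<^sub>m n" "resolvent T * M = 1\<^sub>m n"
proof -
  have M: "M \<in> carrier_mat n n"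
    using T by (auto simp: M_def)
  interpret to_fract: comm_ring_hom "to_fract :: real poly \<Rightarrow> ratfun"
    by unfold_locales auto
  have "M = map_mat to_fract (char_poly_matrix T)"
    using T by (intro eq_matI)
      (auto simp: M_def char_poly_matrix_def rf_z_def rf_const_def simp flip: to_fract_diff to_fract_uminus)
  then have "det M = to_fract (char_poly T)"
    by (simp add: char_poly_def)
  moreover have "char_poly T \<noteq> 0"
    using degree_monic_char_poly[OF T] by auto
  ultimately have "M \<in> Units (ring_mat TYPE(ratfun) n ())"
    by (intro det_non_zero_imp_unit[OF M]) simp
  then obtain Z where "mat_inverse M = Some Z"
    using mat_inverse(1)[OF M, of "()"] by (cases "mat_inverse M") auto
  moreover have "resolvent T = the (mat_inverse M)"
    using T by (simp add: resolvent_def M_def)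
  ultimately show "resolvent T \<in> carrier_mat n n" "M * resolvent T = 1\<^sub>m n" "resolvent T * M = 1\<^sub>m n"
    using mat_inverse(2)[OF M] by auto
qed

definition coeff_at_infinity :: "int \<Rightarrow> ratfun mat \<Rightarrow> real mat" where
  "coeff_at_infinity k = map_mat (\<lambda>f. fls_nth (laurent_at_infinity f) k)"

lemma coeff_at_infinity_dim [simp]:
  "dim_row (coeff_at_infinity k X) = dim_row X" "dim_col (coeff_at_infinity k X) = dim_col X"
  by (simp_all add: coeff_at_infinity_def)

lemma coeff_at_infinity_index [simp]:
  assumes "i < dim_row X" "j < dim_col X"
  shows "coeff_at_infinity k X $$ (i, j) = fls_nth (laurent_at_infinity (X $$ (i, j))) k"
  using assms by (simp add: coeff_at_infinity_def)

lemma coeff_at_infinity_const_mult: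
  assumes "P \<in> carrier_mat r n" "X \<in> carrier_mat n c"
  shows "coeff_at_infinity k (map_mat rf_const P * X) = P * coeff_at_infinity k X"
  using assms
  by (intro eq_matI)
    (auto simp: coeff_at_infinity_def scalar_prod_def laurent_at_infinity_hom.hom_sum laurent_at_infinity_mult
      laurent_at_infinity_rf_const fls_nth_sum intro!: sum.cong)

lemma coeff_at_infinity_mult_const:
  assumes "X \<in> carrier_mat r n" "W \<in> carrier_mat n c"
  shows "coeff_at_infinity k (X * map_mat rf_const W) = coeff_at_infinity k X * W"
  using assms
  by (intro eq_matI)
    (auto simp: coeff_at_infinity_def scalar_prod_def laurent_at_infinity_hom.hom_sum laurent_at_infinity_mult
      laurent_at_infinity_rf_const fls_nth_sum intro!: sum.cong)

lemma eq_mat_if_coeff_at_infinity_eq: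
  assumes "X \<in> carrier_mat r c" "Y \<in> carrier_mat r c"
    and "\<And>k. coeff_at_infinity k X = coeff_at_infinity k Y"
  shows "X = Y"
proof (rule eq_matI)
  fix i j assume ij: "i < dim_row Y" "j < dim_col Y"
  have "fls_nth (laurent_at_infinity (X $$ (i, j))) k = fls_nth (laurent_at_infinity (Y $$ (i, j))) k" for k
    using arg_cong[OF assms(3)[of k], of "\<lambda>M. M $$ (i, j)"] ij assms(1,2) by simp
  then show "X $$ (i, j) = Y $$ (i, j)"
    by (simp add: fls_eq_iff flip: laurent_at_infinity_hom.eq_iff)
qed (use assms in auto)

text \<open>
  Multiplication by \<open>z\<close> shifts coefficients by one, so \<open>z Z = I + T Z\<close> is a recurrence for the
  coefficients of the resolvent \<open>Z\<close>.
\<close>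

lemma coeff_at_infinity_resolvent_step:
  assumes T: "T \<in> carrier_mat n n"
  shows "coeff_at_infinity (k + 1) (resolvent T) =
    (if k = 0 then 1\<^sub>m n else 0\<^sub>m n n) + T * coeff_at_infinity k (resolvent T)"
proof -
  let ?Z = "resolvent T"
  note Z = resolvent_inverse[OF T]
  have Tc: "map_mat rf_const T \<in> carrier_mat n n"
    using T by simp
  have "(rf_z \<cdot>\<^sub>m 1\<^sub>m n) * ?Z - map_mat rf_const T * ?Z = 1\<^sub>m n"
    using Z(2) minus_mult_distrib_mat[OF _ Tc Z(1), of "rf_z \<cdot>\<^sub>m 1\<^sub>m n"] by simp
  moreover have "(rf_z \<cdot>\<^sub>m 1\<^sub>m n) * ?Z = rf_z \<cdot>\<^sub>m ?Z"
    using Z(1) by (subst mult_smult_assoc_mat[of _ n n _ n]) auto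
  ultimately have *: "rf_z \<cdot>\<^sub>m ?Z - map_mat rf_const T * ?Z = 1\<^sub>m n"
    by simp
  show ?thesis
  proof (rule eq_matI)
    fix i j assume "i < dim_row ((if k = 0 then 1\<^sub>m n else 0\<^sub>m n n) + T * coeff_at_infinity k ?Z)"
      "j < dim_col ((if k = 0 then 1\<^sub>m n else 0\<^sub>m n n) + T * coeff_at_infinity k ?Z)"
    then have ij: "i < n" "j < n"
      using T Z(1) by (auto simp: coeff_at_infinity_def)
    have dims [simp]: "dim_row T = n" "dim_row ?Z = n" "dim_col ?Z = n"
      using T Z(1) by auto
    have "rf_z * ?Z $$ (i, j) = 1\<^sub>m n $$ (i, j) + (map_mat rf_const T * ?Z) $$ (i, j)"
      using arg_cong[OF *, of "\<lambda>M. M $$ (i, j)"] ij by (simp add: algebra_simps)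
    then have "fls_nth (laurent_at_infinity (rf_z * ?Z $$ (i, j))) k =
        fls_nth (laurent_at_infinity (1\<^sub>m n $$ (i, j))) k + coeff_at_infinity k (map_mat rf_const T * ?Z) $$ (i, j)"
      using ij by (simp add: laurent_at_infinity_add)
    moreover have "fls_nth (laurent_at_infinity (rf_z * ?Z $$ (i, j))) k = coeff_at_infinity (k + 1) ?Z $$ (i, j)"
      using ij by (simp add: laurent_at_infinity_mult laurent_at_infinity_rf_z fls_X_inv_times_conv_shift)
    ultimately show "coeff_at_infinity (k + 1) ?Z $$ (i, j) =
        ((if k = 0 then 1\<^sub>m n else 0\<^sub>m n n) + T * coeff_at_infinity k ?Z) $$ (i, j)"
      using ij by (auto simp: coeff_at_infinity_const_mult[OF T Z(1)] laurent_at_infinity_1)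
  qed (use T Z(1) in \<open>auto simp: coeff_at_infinity_def\<close>)
qed

text \<open>
  The recurrence alone does not determine the coefficients: it also needs a start. A Laurent series
  has only finitely many terms of negative index, so below some \<open>l\<close> all coefficients vanish, and the
  recurrence carries this up to index \<open>0\<close>; the identity matrix first enters at index \<open>1\<close>.
\<close>

lemma coeff_at_infinity_resolvent_nonpos:
  assumes T: "T \<in> carrier_mat n n" and "k \<le> 0"
  shows "coeff_at_infinity k (resolvent T) = 0\<^sub>m n n"
proof -
  let ?Z = "resolvent T"
  note Z = resolvent_inverse(1)[OF T]
  define F where "F = (\<lambda>(i, j). fls_subdegree (laurent_at_infinity (?Z $$ (i, j)))) ` ({..<n} \<times> {..<n})"
  define l where "l = Min (insert 0 F)"
  have low: "coeff_at_infinity k' ?Z = 0\<^sub>m n n" if "k' < l" for k'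
  proof (rule eq_matI)
    fix i j assume "i < dim_row (0\<^sub>m n n :: real mat)" "j < dim_col (0\<^sub>m n n :: real mat)"
    then have ij: "i < n" "j < n"
      by auto
    then have "l \<le> fls_subdegree (laurent_at_infinity (?Z $$ (i, j)))"
      unfolding l_def by (intro Min_le) (auto simp: F_def)
    then show "coeff_at_infinity k' ?Z $$ (i, j) = 0\<^sub>m n n $$ (i, j)"
      using ij Z that by simp
  qed (use Z in \<open>auto simp: coeff_at_infinity_def\<close>)
  have up: "coeff_at_infinity (l - 1 + int d) ?Z = 0\<^sub>m n n" if "l - 1 + int d \<le> 0" for d
    using that
  proof (induction d)
    case (Suc d)
    then show ?case
      using coeff_at_infinity_resolvent_step[OF T, of "l - 1 + int d"] T
      by (simp add: algebra_simps)
  qed (use low in simp)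
  show ?thesis
  proof (cases "k < l")
    case False
    then show ?thesis
      using up[of "nat (k - (l - 1))"] \<open>k \<le> 0\<close> by simp
  qed (rule low)
qed

lemma coeff_at_infinity_resolvent_Suc:
  assumes T: "T \<in> carrier_mat n n"
  shows "coeff_at_infinity (int k + 1) (resolvent T) = T ^\<^sub>m k"
proof (induction k)
  case 0
  show ?case
    using coeff_at_infinity_resolvent_step[OF T, of 0] coeff_at_infinity_resolvent_nonpos[OF T, of 0] T
    by simp
next
  case (Suc k)
  then show ?case
    using coeff_at_infinity_resolvent_step[OF T, of "int k + 1"] T pow_mat_Suc_left[OF T, of k]
    by (simp add: algebra_simps)
qed

text \<open>
  The expansion \<open>P (z I - T)\<inverse> W = P W / z + P T W / z\<^sup>2 + P T\<^sup>2 W / z\<^sup>3 + \<dots>\<close>.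
\<close>

lemma coeff_at_infinity_markov:
  assumes "P \<in> carrier_mat r n" "T \<in> carrier_mat n n" "W \<in> carrier_mat n c"
  shows "coeff_at_infinity (int k + 1) (transfer_mat T W P) = P * T ^\<^sub>m k * W"
    "l \<le> 0 \<Longrightarrow> coeff_at_infinity l (transfer_mat T W P) = 0\<^sub>m r c"
proof -
  note Z = resolvent_inverse(1)[OF assms(2)]
  have PZ: "map_mat rf_const P * resolvent T \<in> carrier_mat r n"
    using assms Z by auto
  have *: "coeff_at_infinity l (transfer_mat T W P) = P * coeff_at_infinity l (resolvent T) * W" for l
    by (simp add: transfer_mat_resolvent coeff_at_infinity_mult_const[OF PZ assms(3)]
        coeff_at_infinity_const_mult[OF assms(1) Z])
  show "coeff_at_infinity (int k + 1) (transfer_mat T W P) = P * T ^\<^sub>m k * W"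
    by (simp add: * coeff_at_infinity_resolvent_Suc[OF assms(2)])
  show "coeff_at_infinity l (transfer_mat T W P) = 0\<^sub>m r c" if "l \<le> 0"
    using assms by (simp add: * coeff_at_infinity_resolvent_nonpos[OF assms(2) that])
qed

lemma transfer_mat_carrier:
  assumes "P \<in> carrier_mat r n" "T \<in> carrier_mat n n" "W \<in> carrier_mat n c"
  shows "transfer_mat T W P \<in> carrier_mat r c"
  using assms resolvent_inverse(1)[OF assms(2)] by (simp add: transfer_mat_resolvent)

lemma transfer_mat_eq_iff_markov_eq:
  assumes "P \<in> carrier_mat r n" "T \<in> carrier_mat n n" "T' \<in> carrier_mat n n" "W \<in> carrier_mat n c"
  shows "transfer_mat T W P = transfer_mat T' W P \<longleftrightarrow> (\<forall>k. P * T ^\<^sub>m k * W = P * T' ^\<^sub>m k * W)"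
proof
  assume "transfer_mat T W P = transfer_mat T' W P"
  then show "\<forall>k. P * T ^\<^sub>m k * W = P * T' ^\<^sub>m k * W"
    using assms by (metis coeff_at_infinity_markov(1))
next
  assume eq: "\<forall>k. P * T ^\<^sub>m k * W = P * T' ^\<^sub>m k * W"
  have "coeff_at_infinity l (transfer_mat T W P) = coeff_at_infinity l (transfer_mat T' W P)" for l
  proof (cases "l \<le> 0")
    case True
    then show ?thesis
      using coeff_at_infinity_markov(2) assms by metis
  next
    case False
    then have "l = int (nat (l - 1)) + 1"
      by simp
    then show ?thesis
      using coeff_at_infinity_markov(1) assms eq by metis
  qed
  then show "transfer_mat T W P = transfer_mat T' W P"
    using eq_mat_if_coeff_at_infinity_eq transfer_mat_carrier assms by metis
qed

section \<open>Output feedback\<close>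

text \<open>
  The resolvent identity, obtained by expanding \<open>Z ((z I - T') - (z I - T)) Z'\<close>, in both orders of the
  two resolvents.
\<close>

lemma resolvent_diff:
  assumes T: "T \<in> carrier_mat n n" and T': "T' \<in> carrier_mat n n"
  shows "resolvent T = resolvent T' + resolvent T * map_mat rf_const (T - T') * resolvent T'"
    "resolvent T = resolvent T' + resolvent T' * map_mat rf_const (T - T') * resolvent T"
proof -
  let ?Z = "resolvent T" and ?Z' = "resolvent T'"
  let ?M = "rf_z \<cdot>\<^sub>m 1\<^sub>m n - map_mat rf_const T" and ?M' = "rf_z \<cdot>\<^sub>m 1\<^sub>m n - map_mat rf_const T'"
  note Z = resolvent_inverse[OF T] and Z' = resolvent_inverse[OF T']
  have M: "?M \<in> carrier_mat n n" "?M' \<in> carrier_mat n n"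
    using T T' by auto
  have diff: "map_mat rf_const (T - T') = ?M' - ?M"
    using T T' by (intro eq_matI) (auto simp: rf_const_hom.hom_minus)
  have "?Z * (?M' - ?M) * ?Z' = (?Z * ?M' - ?Z * ?M) * ?Z'"
    using M Z(1) by (simp add: mult_minus_distrib_mat[of _ n n _ n])
  also have "\<dots> = ?Z * ?M' * ?Z' - ?Z * ?M * ?Z'"
    using M Z(1) Z'(1) by (intro minus_mult_distrib_mat[of _ n n _ _ n]) auto
  also have "\<dots> = ?Z - ?Z'"
    using M Z Z' by (simp add: assoc_mult_mat[of _ n n _ n _ n])
  finally show "?Z = ?Z' + ?Z * map_mat rf_const (T - T') * ?Z'"
    using Z(1) Z'(1) unfolding diff by (intro eq_matI) auto
  have "?Z' * (?M' - ?M) * ?Z = (?Z' * ?M' - ?Z' * ?M) * ?Z"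
    using M Z'(1) by (simp add: mult_minus_distrib_mat[of _ n n _ n])
  also have "\<dots> = ?Z' * ?M' * ?Z - ?Z' * ?M * ?Z"
    using M Z(1) Z'(1) by (intro minus_mult_distrib_mat[of _ n n _ _ n]) auto
  also have "\<dots> = ?Z - ?Z'"
    using M Z Z' by (simp add: assoc_mult_mat[of _ n n _ n _ n])
  finally show "?Z = ?Z' + ?Z' * map_mat rf_const (T - T') * ?Z"
    using Z(1) Z'(1) unfolding diff by (intro eq_matI) auto
qed

text \<open>
  The sum in the middle has the shape of a resolvent expressed by the resolvent identity, for state
  matrices that differ by \<open>B D C\<close>.
\<close>

lemma mult_mat_perturbed:
  fixes C :: "'a::comm_ring_1 mat"
  assumes "C \<in> carrier_mat p n" "X \<in> carrier_mat n n" "Y \<in> carrier_mat n n"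
    "B \<in> carrier_mat n m" "D \<in> carrier_mat m p" "X' \<in> carrier_mat n n"
  shows "C * (X + Y * (B * D * C) * X') * B = C * X * B + C * Y * B * D * (C * X' * B)"
proof -
  have dims: "dim_row C = p" "dim_col C = n" "dim_row X = n" "dim_col X = n" "dim_row Y = n" "dim_col Y = n"
    "dim_row B = n" "dim_col B = m" "dim_row D = m" "dim_col D = p" "dim_row X' = n" "dim_col X' = n"
    using assms by auto
  have "Y * (B * D * C) * X' \<in> carrier_mat n n"
    using dims by (intro carrier_matI) auto
  then have "C * (X + Y * (B * D * C) * X') * B = C * X * B + C * (Y * (B * D * C) * X') * B"
    using assms by (simp add: mult_add_distrib_mat[of _ p n _ n] add_mult_distrib_mat[of _ p n _ _ m] mult_carrier_mat)
  also have "C * (Y * (B * D * C) * X') * B = C * Y * B * D * (C * X' * B)"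
    by (simp add: assoc_mult_mat_dim dims del: assoc_mult_mat)
  finally show ?thesis .
qed

text \<open>
  The resolvent identity seen from input and output: the difference of two closed-loop state matrices
  factors as \<open>B (K - K') C\<close>, and the outer factors turn the adjacent resolvents into transfer matrices.
\<close>

lemma transfer_mat_feedback_diff:
  assumes A: "A \<in> carrier_mat n n" and B: "B \<in> carrier_mat n m" and C: "C \<in> carrier_mat p n"
    and K: "K \<in> carrier_mat m p" and K': "K' \<in> carrier_mat m p"
  defines "H \<equiv> \<lambda>K. transfer_mat (A + B * K * C) B C"
  shows "H K = H K' + H K * map_mat rf_const (K - K') * H K'"
    "H K = H K' + H K' * map_mat rf_const (K - K') * H K"
proof -
  let ?c = "map_mat rf_const" and ?D = "K - K'"
  let ?T = "A + B * K * C" and ?T' = "A + B * K' * C"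
  let ?Z = "resolvent ?T" and ?Z' = "resolvent ?T'"
  have TT: "?T \<in> carrier_mat n n" "?T' \<in> carrier_mat n n" and D: "?D \<in> carrier_mat m p"
    using A B C K K' by auto
  note Z = resolvent_inverse(1)[OF TT(1)] resolvent_inverse(1)[OF TT(2)]
  have "B * K * C - B * K' * C = B * (K - K') * C"
    using B C K K' by (simp add: minus_mult_distrib_mat[of _ n p _ _ n] mult_minus_distrib_mat[of _ n m _ p])
  moreover have "?T - ?T' = B * K * C - B * K' * C"
    using A B C K K' by (intro eq_matI) auto
  ultimately have TTD: "?T - ?T' = B * ?D * C"
    by simp
  have cTTD: "?c (?T - ?T') = ?c B * ?c ?D * ?c C"
    unfolding TTD using B C D
    by (subst rf_const_hom.mat_hom_mult[of _ n p _ n] rf_const_hom.mat_hom_mult[of _ n m _ p]; auto)+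
  have cc: "?c B \<in> carrier_mat n m" "?c C \<in> carrier_mat p n" "?c ?D \<in> carrier_mat m p"
    using B C D by auto
  note sandwich = mult_mat_perturbed[OF cc(2) _ _ cc(1,3) _]
  show "H K = H K' + H K * ?c ?D * H K'"
    unfolding H_def transfer_mat_resolvent
    using sandwich[OF Z(2,1,2)] resolvent_diff(1)[OF TT] unfolding cTTD by simp
  show "H K = H K' + H K' * ?c ?D * H K"
    unfolding H_def transfer_mat_resolvent
    using sandwich[OF Z(2,2,1)] resolvent_diff(2)[OF TT] unfolding cTTD by simp
qed

lemma mult_mat_sandwich_eq_0:
  fixes U :: "'a::comm_ring_1 mat"
  assumes "U \<in> carrier_mat a b" "Y \<in> carrier_mat b c" "D \<in> carrier_mat c d"
    "Y' \<in> carrier_mat d e" "V \<in> carrier_mat e f" and 0: "Y * D * Y' = 0\<^sub>m b e"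
  shows "U * Y * D * (Y' * V) = 0\<^sub>m a f"
proof -
  have dims: "dim_col U = b" "dim_row Y = b" "dim_col Y = c" "dim_row D = c" "dim_col D = d"
    "dim_row Y' = d" "dim_col Y' = e" "dim_row V = e"
    using assms by auto
  have "U * Y * D * (Y' * V) = U * (Y * D * Y') * V"
    by (simp add: assoc_mult_mat_dim dims del: assoc_mult_mat)
  then show ?thesis
    using assms by simp
qed

text \<open>
  The closed loop \<open>H(K)\<close> is obtained from \<open>G\<close> by multiplication with \<open>I + H(K) K\<close> on the left or
  \<open>I + K H(K)\<close> on the right, and \<open>I - G K\<close> or \<open>I - K G\<close> undoes this. Hence \<open>H(K) (K - K') H(K')\<close>, the
  difference of the closed loops, vanishes exactly when \<open>G (K - K') G\<close> does.
\<close>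

lemma transfer_mat_feedback_eq_iff:
  assumes A: "A \<in> carrier_mat n n" and B: "B \<in> carrier_mat n m" and C: "C \<in> carrier_mat p n"
    and K: "K \<in> carrier_mat m p" and K': "K' \<in> carrier_mat m p"
  defines "G \<equiv> transfer_mat A B C"
  shows "transfer_mat (A + B * K * C) B C = transfer_mat (A + B * K' * C) B C \<longleftrightarrow>
    G * map_mat rf_const (K - K') * G = 0\<^sub>m p m"
proof -
  let ?c = "map_mat rf_const"
  define H where "H = (\<lambda>K. transfer_mat (A + B * K * C) B C)"
  define D where "D = ?c (K - K')"
  have D: "D \<in> carrier_mat m p"
    using K K' by (simp add: D_def minus_carrier_mat)
  have H: "H L \<in> carrier_mat p m" if "L \<in> carrier_mat m p" for L
    unfolding H_def using A B C that by (intro transfer_mat_carrier) auto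
  have H0: "H (0\<^sub>m m p) = G"
    unfolding H_def G_def using A B C by simp
  then have G: "G \<in> carrier_mat p m"
    using H by force
  have diff0: "L - 0\<^sub>m m p = L" if "L \<in> carrier_mat m p" for L :: "real mat"
    using that by (intro eq_matI) auto
  \<comment> \<open>The open loop \<open>G\<close> is the closed loop for the zero feedback.\<close>
  have loop: "H L = G + H L * ?c L * G" "H L = G + G * ?c L * H L" if L: "L \<in> carrier_mat m p" for L
    using transfer_mat_feedback_diff[OF A B C L zero_carrier_mat] diff0[OF L] H0
    unfolding H_def by auto
  have diff: "H K = H K' + H K * D * H K'"
    using transfer_mat_feedback_diff(1)[OF A B C K K'] unfolding H_def D_def by simp
  have HDH: "H K * D * H K' \<in> carrier_mat p m"
    using H K K' D by (meson mult_carrier_mat)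
  have "H K = H K' \<longleftrightarrow> H K * D * H K' = 0\<^sub>m p m"
  proof
    assume eq: "H K = H K'"
    show "H K * D * H K' = 0\<^sub>m p m"
    proof (rule eq_matI)
      fix i j assume "i < dim_row (0\<^sub>m p m :: ratfun mat)" "j < dim_col (0\<^sub>m p m :: ratfun mat)"
      then have ij: "i < p" "j < m"
        by auto
      have "H K $$ (i, j) = (H K' + H K * D * H K') $$ (i, j)"
        using diff by simp
      also have "\<dots> = H K' $$ (i, j) + (H K * D * H K') $$ (i, j)"
        using ij HDH by (intro index_add_mat) auto
      finally show "(H K * D * H K') $$ (i, j) = 0\<^sub>m p m $$ (i, j)"
        using eq ij by simp
    qed (use HDH in auto)
  next
    assume "H K * D * H K' = 0\<^sub>m p m"
    then show "H K = H K'"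
      using diff H[OF K'] by simp
  qed
  also have "\<dots> \<longleftrightarrow> G * D * G = 0\<^sub>m p m"
  proof
    assume HDH0: "H K * D * H K' = 0\<^sub>m p m"
    have "G = (1\<^sub>m p - G * ?c K) * H K"
    proof -
      have GKH: "G * ?c K * H K \<in> carrier_mat p m"
        using G K H[OF K] by (intro mult_carrier_mat) auto
      have "(1\<^sub>m p - G * ?c K) * H K = H K - G * ?c K * H K"
        using G K H[OF K] by (subst minus_mult_distrib_mat[of _ p p _ _ m]) auto
      also have "\<dots> = (G + G * ?c K * H K) - G * ?c K * H K"
        using loop(2)[OF K] by simp
      also have "\<dots> = G"
        by (rule add_diff_cancel_mat[OF G GKH])
      finally show ?thesis ..
    qed
    moreover have "G = H K' * (1\<^sub>m m - ?c K' * G)"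
    proof -
      have HKG: "H K' * ?c K' * G \<in> carrier_mat p m"
        using G K' H[OF K'] by (intro mult_carrier_mat) auto
      have "H K' * (1\<^sub>m m - ?c K' * G) = H K' - H K' * ?c K' * G"
        using G K' H[OF K'] by (subst mult_minus_distrib_mat[of _ p m _ m]) (auto simp: assoc_mult_mat[of _ p m _ p _ m])
      also have "\<dots> = (G + H K' * ?c K' * G) - H K' * ?c K' * G"
        using loop(1)[OF K'] by simp
      also have "\<dots> = G"
        by (rule add_diff_cancel_mat[OF G HKG])
      finally show ?thesis ..
    qed
    moreover have "1\<^sub>m p - G * ?c K \<in> carrier_mat p p" "1\<^sub>m m - ?c K' * G \<in> carrier_mat m m"
      using G K K' by auto
    ultimately show "G * D * G = 0\<^sub>m p m"
      using mult_mat_sandwich_eq_0[OF _ H[OF K] D H[OF K'] _ HDH0] by metis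
  next
    assume GDG0: "G * D * G = 0\<^sub>m p m"
    have HK: "H K = (1\<^sub>m p + H K * ?c K) * G"
      using G K H[OF K] loop(1)[OF K] by (subst add_mult_distrib_mat[of _ p p _ _ m]) auto
    have HK': "H K' = G * (1\<^sub>m m + ?c K' * H K')"
      using G K' H[OF K'] loop(2)[OF K']
      by (subst mult_add_distrib_mat[of _ p m _ m]) (auto simp: assoc_mult_mat[of _ p m _ p _ m])
    have "1\<^sub>m p + H K * ?c K \<in> carrier_mat p p" "1\<^sub>m m + ?c K' * H K' \<in> carrier_mat m m"
      using mult_carrier_mat[OF H[OF K], of "?c K" p] mult_carrier_mat[OF _ H[OF K'], of "?c K'" m] K K'
      by simp_all
    from mult_mat_sandwich_eq_0[OF this(1) G D G this(2) GDG0]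
    show "H K * D * H K' = 0\<^sub>m p m"
      unfolding HK[symmetric] HK'[symmetric] .
  qed
  finally show ?thesis
    by (simp add: H_def D_def)
qed

section \<open>Block matrices\<close>

text \<open>
  The inclusion of the \<open>i\<close>-th summand into a direct sum of spaces of dimensions \<open>d 0, \<dots>, d (N - 1)\<close>.
  Multiplying by these matrices and their transposes extracts and inserts blocks, which keeps index
  arithmetic out of the arguments about transfer matrices.
\<close>

definition block_embedding :: "nat \<Rightarrow> (nat \<Rightarrow> nat) \<Rightarrow> nat \<Rightarrow> 'a::zero_neq_one mat" where
  "block_embedding N d i =
     mat (\<Sum>k<N. d k) (d i) (\<lambda>(r, c). if r = (\<Sum>k<i. d k) + c then 1 else 0)"

lemma block_embedding_carrier [simp]: "block_embedding N d i \<in> carrier_mat (\<Sum>k<N. d k) (d i)"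
  by (simp add: block_embedding_def)

lemma block_offset_mono:
  fixes d :: "nat \<Rightarrow> nat"
  assumes "i < j"
  shows "(\<Sum>k<i. d k) + d i \<le> (\<Sum>k<j. d k)"
proof -
  have "(\<Sum>k<i. d k) + d i = (\<Sum>k<Suc i. d k)"
    by simp
  also have "\<dots> \<le> (\<Sum>k<j. d k)"
    using assms by (intro sum_mono2) auto
  finally show ?thesis .
qed

lemma block_offset_less:
  fixes d :: "nat \<Rightarrow> nat"
  assumes "i < N" "c < d i"
  shows "(\<Sum>k<i. d k) + c < (\<Sum>k<N. d k)"
  using block_offset_mono[OF assms(1), of d] assms(2) by simp

lemma block_offset_cases:
  fixes d :: "nat \<Rightarrow> nat"
  assumes "r < (\<Sum>k<N. d k)"
  obtains i c where "i < N" "c < d i" "r = (\<Sum>k<i. d k) + c"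
  using assms
proof (induction N arbitrary: thesis)
  case (Suc N)
  show ?case
  proof (cases "r < (\<Sum>k<N. d k)")
    case True
    then show ?thesis
      using Suc.IH Suc.prems(1) less_Suc_eq by metis
  next
    case False
    then show ?thesis
      using Suc.prems(1)[of N "r - (\<Sum>k<N. d k)"] Suc.prems(2) by auto
  qed
qed simp

lemma index_mult_block_embedding:
  fixes M :: "'a::comm_ring_1 mat"
  assumes "M \<in> carrier_mat r (\<Sum>k<N. d k)" "i < N" "a < r" "c < d i"
  shows "(M * block_embedding N d i) $$ (a, c) = M $$ (a, (\<Sum>k<i. d k) + c)"
proof -
  have "(M * block_embedding N d i) $$ (a, c) =
      (\<Sum>l = 0..<(\<Sum>k<N. d k). M $$ (a, l) * (if l = (\<Sum>k<i. d k) + c then 1 else 0))"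
    using assms by (simp add: block_embedding_def scalar_prod_def)
  then show ?thesis
    using block_offset_less[of i N c d] assms by (simp add: if_distrib cong: if_cong)
qed

lemma index_transpose_block_embedding_mult:
  fixes M :: "'a::comm_ring_1 mat"
  assumes "M \<in> carrier_mat (\<Sum>k<N. d k) r" "i < N" "a < d i" "c < r"
  shows "(transpose_mat (block_embedding N d i) * M) $$ (a, c) = M $$ ((\<Sum>k<i. d k) + a, c)"
proof -
  have "(transpose_mat (block_embedding N d i) * M) $$ (a, c) =
      (\<Sum>l = 0..<(\<Sum>k<N. d k). (if l = (\<Sum>k<i. d k) + a then 1 else 0) * M $$ (l, c))"
    using assms by (simp add: block_embedding_def scalar_prod_def)
  then show ?thesis
    using block_offset_less[of i N a d] assms by (simp add: if_distrib if_distribR cong: if_cong)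
qed

lemma block_diag_carrier:
  assumes "\<And>i. i < N \<Longrightarrow> M i \<in> carrier_mat (r i) (c i)"
  shows "block_diag N M \<in> carrier_mat (\<Sum>k<N. r k) (\<Sum>k<N. c k)"
proof -
  have "sum_list (map dim_row (map M [0..<N])) = (\<Sum>k<N. r k)"
    "sum_list (map dim_col (map M [0..<N])) = (\<Sum>k<N. c k)"
    using assms by (auto simp: interv_sum_list_conv_sum_set_nat atLeast0LessThan intro!: sum.cong)
  then show ?thesis
    by (intro carrier_matI) (simp_all add: block_diag_def dim_diag_block_mat)
qed

lemma block_diag_Suc:
  "block_diag (Suc N) M = four_block_mat (block_diag N M)
    (0\<^sub>m (dim_row (block_diag N M)) (dim_col (M N))) (0\<^sub>m (dim_row (M N)) (dim_col (block_diag N M))) (M N)"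
  by (simp add: block_diag_def diag_block_mat_last Let_def)

lemma block_diag_index:
  assumes "\<And>i. i < N \<Longrightarrow> M i \<in> carrier_mat (r i) (c i)"
    and "i < N" "a < r i" "j < N" "b < c j"
  shows "block_diag N M $$ ((\<Sum>k<i. r k) + a, (\<Sum>k<j. c k) + b) = (if i = j then M i $$ (a, b) else 0)"
  using assms
proof (induction N)
  case (Suc N)
  have D: "block_diag N M \<in> carrier_mat (\<Sum>k<N. r k) (\<Sum>k<N. c k)"
    using Suc.prems(1) by (intro block_diag_carrier) auto
  have MN: "M N \<in> carrier_mat (r N) (c N)"
    using Suc.prems(1) by simp
  have lt: "(\<Sum>k<i. r k) + a < (\<Sum>k<Suc N. r k)" "(\<Sum>k<j. c k) + b < (\<Sum>k<Suc N. c k)"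
    using block_offset_less[of i "Suc N" a r] block_offset_less[of j "Suc N" b c] Suc.prems(2-5) by blast+
  have row: "(\<Sum>k<i. r k) + a < (\<Sum>k<N. r k) \<longleftrightarrow> i < N"
    using block_offset_less[of i N a r] Suc.prems(2,3) by (cases "i = N") auto
  have col: "(\<Sum>k<j. c k) + b < (\<Sum>k<N. c k) \<longleftrightarrow> j < N"
    using block_offset_less[of j N b c] Suc.prems(4,5) by (cases "j = N") auto
  show ?case
    using Suc.IH[OF Suc.prems(1)] Suc.prems(2-5) D MN lt row col
    unfolding block_diag_Suc
    by (cases "i = N"; cases "j = N") auto
qed simp

lemma block_diag_mult_block_embedding:
  fixes M :: "nat \<Rightarrow> 'a::comm_ring_1 mat"
  assumes M: "\<And>i. i < N \<Longrightarrow> M i \<in> carrier_mat (r i) (c i)" and "i < N"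
  shows "block_diag N M * block_embedding N c i = block_embedding N r i * M i"
proof (rule eq_matI)
  note D = block_diag_carrier[of N M r c, OF M]
  fix x b assume "x < dim_row (block_embedding N r i * M i)" "b < dim_col (block_embedding N r i * M i)"
  then have x: "x < (\<Sum>k<N. r k)" and b: "b < c i"
    using M[OF \<open>i < N\<close>] by (auto simp: block_embedding_def)
  obtain j a where ja: "j < N" "a < r j" "x = (\<Sum>k<j. r k) + a"
    using x by (rule block_offset_cases)
  have "(block_diag N M * block_embedding N c i) $$ (x, b) = (if j = i then M j $$ (a, b) else 0)"
    using index_mult_block_embedding[OF D \<open>i < N\<close> x b] block_diag_index[OF M ja(1,2) \<open>i < N\<close> b] ja(3) by simp
  moreover have "(block_embedding N r i * M i) $$ (x, b) = (if j = i then M j $$ (a, b) else 0)"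
  proof -
    have "(block_embedding N r i * M i) $$ (x, b) =
        (\<Sum>l = 0..<r i. (if x = (\<Sum>k<i. r k) + l then 1 else 0) * M i $$ (l, b))"
      using M[OF \<open>i < N\<close>] x b by (simp add: block_embedding_def scalar_prod_def)
    also have "\<dots> = (\<Sum>l = 0..<r i. if l = a then (if j = i then M i $$ (l, b) else 0) else 0)"
    proof (intro sum.cong refl)
      fix l assume l: "l \<in> {0..<r i}"
      have "x = (\<Sum>k<i. r k) + l \<longleftrightarrow> j = i \<and> l = a"
        using ja(2,3) l block_offset_mono[of i j r] block_offset_mono[of j i r]
        by (cases i j rule: linorder_cases) auto
      then show "(if x = (\<Sum>k<i. r k) + l then 1 else 0) * M i $$ (l, b) =
          (if l = a then (if j = i then M i $$ (l, b) else 0) else 0)"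
        by simp
    qed
    also have "\<dots> = (if j = i then M j $$ (a, b) else 0)"
      using ja(2) by auto
    finally show ?thesis .
  qed
  ultimately show "(block_diag N M * block_embedding N c i) $$ (x, b) = (block_embedding N r i * M i) $$ (x, b)"
    by simp
qed (use M[OF \<open>i < N\<close>] block_diag_carrier[of N M r c, OF M] in \<open>auto simp: block_embedding_def\<close>)

lemma transpose_block_diag:
  fixes M :: "nat \<Rightarrow> 'a::zero mat"
  assumes M: "\<And>i. i < N \<Longrightarrow> M i \<in> carrier_mat (r i) (c i)"
  shows "transpose_mat (block_diag N M) = block_diag N (\<lambda>i. transpose_mat (M i))"
  using assms
proof (induction N)
  case (Suc N)
  have "transpose_mat (four_block_mat D (0\<^sub>m (dim_row D) (dim_col E)) (0\<^sub>m (dim_row E) (dim_col D)) E) =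
      four_block_mat (transpose_mat D) (0\<^sub>m (dim_col D) (dim_row E)) (0\<^sub>m (dim_col E) (dim_row D)) (transpose_mat E)"
    for D E :: "'a mat"
    by (intro eq_matI) auto
  moreover have "block_diag N (\<lambda>i. transpose_mat (M i)) = transpose_mat (block_diag N M)"
    using Suc by simp
  ultimately show ?case
    by (simp add: block_diag_Suc)
qed (simp add: block_diag_def)

lemma transpose_block_embedding_mult_block_diag:
  fixes M :: "nat \<Rightarrow> 'a::comm_ring_1 mat"
  assumes M: "\<And>i. i < N \<Longrightarrow> M i \<in> carrier_mat (r i) (c i)" and "i < N"
  shows "transpose_mat (block_embedding N r i) * block_diag N M = M i * transpose_mat (block_embedding N c i)"
proof -
  have "transpose_mat (transpose_mat (block_embedding N r i) * block_diag N M) =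
      transpose_mat (block_diag N M) * block_embedding N r i"
    by (subst transpose_mult[of _ "r i" "\<Sum>k<N. r k" _ "\<Sum>k<N. c k"]) (use block_diag_carrier[of N M r c, OF M] in auto)
  also have "transpose_mat (block_diag N M) = block_diag N (\<lambda>i. transpose_mat (M i))"
    using M by (rule transpose_block_diag)
  also have "\<dots> * block_embedding N r i = block_embedding N c i * transpose_mat (M i)"
    by (rule block_diag_mult_block_embedding) (use M \<open>i < N\<close> in auto)
  also have "\<dots> = transpose_mat (M i * transpose_mat (block_embedding N c i))"
    using M[OF \<open>i < N\<close>] by (subst transpose_mult[of _ "r i" "c i" _ "\<Sum>k<N. c k"]) auto
  finally show ?thesis
    by (metis transpose_transpose)
qed

lemma eq_mat_if_blocks_eq:
  fixes X Y :: "'a::comm_ring_1 mat"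
  assumes X: "X \<in> carrier_mat (\<Sum>k<N. r k) (\<Sum>k<N. c k)" and Y: "Y \<in> carrier_mat (\<Sum>k<N. r k) (\<Sum>k<N. c k)"
    and eq: "\<And>i j. i < N \<Longrightarrow> j < N \<Longrightarrow>
      transpose_mat (block_embedding N r i) * X * block_embedding N c j =
      transpose_mat (block_embedding N r i) * Y * block_embedding N c j"
  shows "X = Y"
proof (rule eq_matI)
  fix x y assume "x < dim_row Y" "y < dim_col Y"
  then have x: "x < (\<Sum>k<N. r k)" and y: "y < (\<Sum>k<N. c k)"
    using Y by auto
  obtain i a where ia: "i < N" "a < r i" "x = (\<Sum>k<i. r k) + a"
    using x by (rule block_offset_cases)
  obtain j b where jb: "j < N" "b < c j" "y = (\<Sum>k<j. c k) + b"
    using y by (rule block_offset_cases)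
  have entry: "(transpose_mat (block_embedding N r i) * Z * block_embedding N c j) $$ (a, b) = Z $$ (x, y)"
    if Z: "Z \<in> carrier_mat (\<Sum>k<N. r k) (\<Sum>k<N. c k)" for Z :: "'a mat"
  proof -
    have "transpose_mat (block_embedding N r i) * Z \<in> carrier_mat (r i) (\<Sum>k<N. c k)"
      using Z by (intro mult_carrier_mat[of _ _ "\<Sum>k<N. r k"]) auto
    from index_mult_block_embedding[OF this jb(1) ia(2) jb(2)]
    show ?thesis
      using index_transpose_block_embedding_mult[OF Z ia(1,2) y] ia(3) jb(3) by simp
  qed
  show "X $$ (x, y) = Y $$ (x, y)"
    using entry[OF X] entry[OF Y] eq[OF ia(1) jb(1)] by simp
qed (use X Y in auto)

lemma transpose_block_embedding_mult_self:
  assumes "i < N"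
  shows "transpose_mat (block_embedding N d i) * block_embedding N d i = (1\<^sub>m (d i) :: 'a::comm_ring_1 mat)"
proof (rule eq_matI)
  fix a b assume "a < dim_row (1\<^sub>m (d i) :: 'a mat)" "b < dim_col (1\<^sub>m (d i) :: 'a mat)"
  then have ab: "a < d i" "b < d i"
    by auto
  show "(transpose_mat (block_embedding N d i) * block_embedding N d i) $$ (a, b) = (1\<^sub>m (d i) :: 'a mat) $$ (a, b)"
    using index_transpose_block_embedding_mult[where M = "block_embedding N d i" and N = N and d = d and r = "d i" and i = i and a = a and c = b] assms
      block_offset_less[of i N _ d, OF assms] ab
    by (simp add: block_embedding_def)
qed (auto simp: block_embedding_def)

lemma block_col_carrier:
  assumes "\<And>i. i < N \<Longrightarrow> M i \<in> carrier_mat (r i) c"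
  shows "block_col c N M \<in> carrier_mat (\<Sum>k<N. r k) c"
proof -
  have "foldr append_rows (map M is) (0\<^sub>m 0 c) \<in> carrier_mat (\<Sum>i\<leftarrow>is. r i) c"
    if "set is \<subseteq> {..<N}" for "is"
    using that by (induction "is") (auto simp: assms)
  from this[of "[0..<N]"] show ?thesis
    by (simp add: block_col_def vcat_def atLeast0LessThan interv_sum_list_conv_sum_set_nat)
qed

lemma block_row_carrier:
  assumes "\<And>i. i < N \<Longrightarrow> M i \<in> carrier_mat r (c i)"
  shows "block_row r N M \<in> carrier_mat r (\<Sum>k<N. c k)"
proof -
  have "foldr append_cols (map M is) (0\<^sub>m r 0) \<in> carrier_mat r (\<Sum>i\<leftarrow>is. c i)"
    if "set is \<subseteq> {..<N}" for "is"
    using that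
  proof (induction "is")
    case (Cons i "is")
    then have "M i \<in> carrier_mat r (c i)"
      using assms by auto
    then show ?case
      using Cons by (auto simp: append_cols_def)
  qed simp
  from this[of "[0..<N]"] show ?thesis
    by (simp add: block_row_def hcat_def atLeast0LessThan interv_sum_list_conv_sum_set_nat)
qed

lemma block_mat_carrier:
  assumes "\<And>i j. i < N \<Longrightarrow> j < N \<Longrightarrow> M i j \<in> carrier_mat (r i) (c j)"
  shows "block_mat N r c M \<in> carrier_mat (\<Sum>k<N. r k) (\<Sum>k<N. c k)"
  unfolding block_mat_def using assms by (intro block_col_carrier block_row_carrier) auto

section \<open>Transfer matrices of decoupled nodes\<close>

text \<open>
  A linear map \<open>E\<close> of state spaces that is compatible with two systems carries the trajectories of one
  to those of the other, hence relates their transfer matrices. The point is that \<open>A E = E A'\<close> passes to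
  the resolvents.
\<close>

lemma transfer_mat_intertwine:
  assumes A: "A \<in> carrier_mat n n" "B \<in> carrier_mat n m" "C \<in> carrier_mat p n"
    and A': "A' \<in> carrier_mat n' n'" "B' \<in> carrier_mat n' m'" "C' \<in> carrier_mat p' n'"
    and E: "E \<in> carrier_mat n n'" and F: "F \<in> carrier_mat m m'" and H: "H \<in> carrier_mat p p'"
    and AE: "A * E = E * A'" and BF: "B * F = E * B'" and CE: "C * E = H * C'"
  shows "transfer_mat A B C * map_mat rf_const F = map_mat rf_const H * transfer_mat A' B' C'"
proof -
  let ?c = "map_mat rf_const"
  let ?M = "rf_z \<cdot>\<^sub>m 1\<^sub>m n - ?c A" and ?M' = "rf_z \<cdot>\<^sub>m 1\<^sub>m n' - ?c A'"
  let ?Z = "resolvent A" and ?Z' = "resolvent A'"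
  note Z = resolvent_inverse[OF A(1)] and Z' = resolvent_inverse[OF A'(1)]
  have dims: "dim_row A = n" "dim_col A = n" "dim_row B = n" "dim_col B = m" "dim_row C = p" "dim_col C = n"
    "dim_row A' = n'" "dim_col A' = n'" "dim_row B' = n'" "dim_col B' = m'" "dim_row C' = p'" "dim_col C' = n'"
    "dim_row E = n" "dim_col E = n'" "dim_row F = m" "dim_col F = m'" "dim_row H = p" "dim_col H = p'"
    "dim_row ?Z = n" "dim_col ?Z = n" "dim_row ?Z' = n'" "dim_col ?Z' = n'"
    using A A' E F H Z(1) Z'(1) by auto
  have cE: "?c E \<in> carrier_mat n n'"
    using E by simp
  have hom: "?c A * ?c E = ?c E * ?c A'" "?c B * ?c F = ?c E * ?c B'" "?c C * ?c E = ?c H * ?c C'"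
    using AE BF CE A A' E F H
    by (metis rf_const_hom.mat_hom_mult)+
  have "?M * ?c E = (rf_z \<cdot>\<^sub>m 1\<^sub>m n) * ?c E - ?c A * ?c E"
    using A E by (intro minus_mult_distrib_mat[of _ n n _ _ n']) auto
  also have "(rf_z \<cdot>\<^sub>m 1\<^sub>m n) * ?c E = ?c E * (rf_z \<cdot>\<^sub>m 1\<^sub>m n')"
    using mult_smult_assoc_mat[OF one_carrier_mat cE] mult_smult_distrib[OF cE one_carrier_mat] cE
    by simp
  also have "?c E * (rf_z \<cdot>\<^sub>m 1\<^sub>m n') - ?c A * ?c E = ?c E * ?M'"
    unfolding hom(1) using A' E by (intro mult_minus_distrib_mat[of _ n n' _ n', symmetric]) auto
  finally have ME: "?M * ?c E = ?c E * ?M'" .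
  have "?Z * ?c E = ?Z * ?c E * (?M' * ?Z')"
    using Z'(2) cE Z(1) by (simp add: mult_carrier_mat[of _ n n _ n'])
  also have "\<dots> = ?Z * (?M * ?c E) * ?Z'"
    unfolding ME by (simp add: assoc_mult_mat_dim dims del: assoc_mult_mat)
  also have "\<dots> = ?Z * ?M * (?c E * ?Z')"
    by (simp add: assoc_mult_mat_dim dims del: assoc_mult_mat)
  also have "\<dots> = ?c E * ?Z'"
    unfolding Z(3) by (rule left_mult_one_mat[OF mult_carrier_mat[OF cE Z'(1)]])
  finally have ZE: "?Z * ?c E = ?c E * ?Z'" .
  have "transfer_mat A B C * ?c F = ?c C * (?Z * (?c B * ?c F))"
    by (simp add: transfer_mat_resolvent assoc_mult_mat_dim dims del: assoc_mult_mat)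
  also have "\<dots> = ?c C * ((?Z * ?c E) * ?c B')"
    unfolding hom by (simp add: assoc_mult_mat_dim dims del: assoc_mult_mat)
  also have "\<dots> = (?c C * ?c E) * (?Z' * ?c B')"
    unfolding ZE by (simp add: assoc_mult_mat_dim dims del: assoc_mult_mat)
  also have "\<dots> = ?c H * transfer_mat A' B' C'"
    unfolding hom by (simp add: transfer_mat_resolvent assoc_mult_mat_dim dims del: assoc_mult_mat)
  finally show ?thesis .
qed

text \<open>
  The network without interconnection acts on each node separately. Both the inclusion of a node and
  the projection onto it (the transposed inclusion) intertwine the node with the whole, which avoids
  computing the inverse of a block diagonal matrix.
\<close>

lemma transfer_mat_block_diag:
  assumes "\<And>i. i < N \<Longrightarrow> A i \<in> carrier_mat (nd i) (nd i)"
    and "\<And>i. i < N \<Longrightarrow> B i \<in> carrier_mat (nd i) (md i)"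
    and "\<And>i. i < N \<Longrightarrow> C i \<in> carrier_mat (pd i) (nd i)"
    and "i < N"
  defines "G \<equiv> transfer_mat (block_diag N A) (block_diag N B) (block_diag N C)"
  shows "G * map_mat rf_const (block_embedding N md i) =
      map_mat rf_const (block_embedding N pd i) * transfer_mat (A i) (B i) (C i)"
    and "transfer_mat (A i) (B i) (C i) * map_mat rf_const (transpose_mat (block_embedding N md i)) =
      map_mat rf_const (transpose_mat (block_embedding N pd i)) * G"
proof -
  note carr = block_diag_carrier[of N A nd nd, OF assms(1)] block_diag_carrier[of N B nd md, OF assms(2)]
    block_diag_carrier[of N C pd nd, OF assms(3)]
  note node = assms(1-3)[OF \<open>i < N\<close>]
  show "G * map_mat rf_const (block_embedding N md i) =
      map_mat rf_const (block_embedding N pd i) * transfer_mat (A i) (B i) (C i)"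
    unfolding G_def
    by (rule transfer_mat_intertwine[OF carr node block_embedding_carrier block_embedding_carrier
        block_embedding_carrier])
      (auto intro!: block_diag_mult_block_embedding assms)
  show "transfer_mat (A i) (B i) (C i) * map_mat rf_const (transpose_mat (block_embedding N md i)) =
      map_mat rf_const (transpose_mat (block_embedding N pd i)) * G"
    unfolding G_def
    by (rule transfer_mat_intertwine[OF node carr, of "transpose_mat (block_embedding N nd i)"])
      (auto intro!: transpose_block_embedding_mult_block_diag[symmetric] assms)
qed

section \<open>Kronecker products and the constant kernel\<close>

lemma index_less_prod:
  fixes a b p m :: nat
  assumes "a < p" "b < m"
  shows "a * m + b < p * m"
proof -
  have "a * m + b < Suc a * m"
    using assms(2) by simp
  also have "\<dots> \<le> p * m"
    using assms(1) by (intro mult_le_mono1) simp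
  finally show ?thesis .
qed

lemma mod_less_of_less_mult:
  fixes k q n :: nat
  assumes "k < n * q"
  shows "k mod q < q"
  using assms by (cases "q = 0") auto

text \<open>
  Column indices of a Kronecker product encode pairs by quotient and remainder, so a sum over them is
  a double sum.
\<close>

lemma sum_div_mod:
  fixes f :: "nat \<Rightarrow> nat \<Rightarrow> 'a::comm_monoid_add"
  shows "(\<Sum>k = 0..<p * m. f (k div m) (k mod m)) = (\<Sum>a = 0..<p. \<Sum>b = 0..<m. f a b)"
proof (cases "m = 0")
  case False
  have "(\<Sum>k = 0..<p * m. f (k div m) (k mod m)) = (\<Sum>(a, b)\<in>{0..<p} \<times> {0..<m}. f a b)"
    by (rule sum.reindex_bij_witness[of _ "\<lambda>(a, b). a * m + b" "\<lambda>k. (k div m, k mod m)"])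
      (use False in \<open>auto simp: less_mult_imp_div_less intro: index_less_prod\<close>)
  then show ?thesis
    by (simp add: sum.cartesian_product)
qed simp

text \<open>
  Columns are stacked on top of each other; this order matches the index convention of
  \<^const>\<open>kronecker\<close>.
\<close>

definition vectorize :: "'a mat \<Rightarrow> 'a vec" where
  "vectorize X = vec (dim_col X * dim_row X) (\<lambda>k. X $$ (k mod dim_row X, k div dim_row X))"

lemma kronecker_transpose_mult_vectorize:
  fixes G H X :: "'a::comm_ring_1 mat"
  assumes H: "H \<in> carrier_mat q m" and X: "X \<in> carrier_mat m p" and G: "G \<in> carrier_mat p n"
  shows "kronecker (transpose_mat G) H *\<^sub>v vectorize X = vectorize (H * X * G)"
proof (rule eq_vecI)
  have HX: "H * X \<in> carrier_mat q p"
    using H X by simp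
  fix k assume "k < dim_vec (vectorize (H * X * G))"
  then have k: "k < n * q"
    using H G by (simp add: vectorize_def)
  then have q: "k mod q < q" "k div q < n"
    by (auto simp: less_mult_imp_div_less mod_less_of_less_mult)
  have "(kronecker (transpose_mat G) H *\<^sub>v vectorize X) $ k =
      (\<Sum>l = 0..<p * m. G $$ (l div m, k div q) * H $$ (k mod q, l mod m) * X $$ (l mod m, l div m))"
    using H X G k q
    by (auto simp: kronecker_def vectorize_def scalar_prod_def less_mult_imp_div_less intro!: sum.cong)
  also have "\<dots> = (\<Sum>a = 0..<p. \<Sum>b = 0..<m. G $$ (a, k div q) * H $$ (k mod q, b) * X $$ (b, a))"
    by (rule sum_div_mod[of "\<lambda>a b. G $$ (a, k div q) * H $$ (k mod q, b) * X $$ (b, a)"])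
  also have "\<dots> = (\<Sum>a = 0..<p. (H * X) $$ (k mod q, a) * G $$ (a, k div q))"
    using H X G q by (auto simp: scalar_prod_def sum_distrib_left sum_distrib_right mult_ac intro!: sum.cong)
  also have "\<dots> = vectorize (H * X * G) $ k"
    using H G k q HX by (auto simp: vectorize_def scalar_prod_def[of "row (H * X) _"] intro!: sum.cong)
  finally show "(kronecker (transpose_mat G) H *\<^sub>v vectorize X) $ k = vectorize (H * X * G) $ k" .
qed (use assms in \<open>simp_all add: kronecker_def vectorize_def\<close>)

lemma vectorize_surj:
  assumes "w \<in> carrier_vec (p * m)"
  obtains X where "X \<in> carrier_mat m p" "w = vectorize X"
proof
  show "mat m p (\<lambda>(b, a). w $ (a * m + b)) \<in> carrier_mat m p"
    by simp
  show "w = vectorize (mat m p (\<lambda>(b, a). w $ (a * m + b)))"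
    using assms
    by (intro eq_vecI) (auto simp: vectorize_def less_mult_imp_div_less mod_less_of_less_mult)
qed

lemma vectorize_eq_0_iff:
  assumes "X \<in> carrier_mat m p"
  shows "vectorize X = 0\<^sub>v (p * m) \<longleftrightarrow> X = 0\<^sub>m m p"
proof
  assume vec: "vectorize X = 0\<^sub>v (p * m)"
  show "X = 0\<^sub>m m p"
  proof (rule eq_matI)
    fix b a assume "b < dim_row (0\<^sub>m m p :: 'a mat)" "a < dim_col (0\<^sub>m m p :: 'a mat)"
    then have "b < m" "a < p"
      by auto
    have "a * m + b < p * m"
      using \<open>a < p\<close> \<open>b < m\<close> by (rule index_less_prod)
    then show "X $$ (b, a) = 0\<^sub>m m p $$ (b, a)"
      using arg_cong[OF vec, of "\<lambda>v. vec_index v (a * m + b)"] assms \<open>b < m\<close> \<open>a < p\<close>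
      by (simp add: vectorize_def)
  qed (use assms in auto)
next
  assume "X = 0\<^sub>m m p"
  then show "vectorize X = 0\<^sub>v (p * m)"
    by (auto simp: vectorize_def less_mult_imp_div_less mod_less_of_less_mult intro!: eq_vecI)
qed

lemma cker_kronecker_trivial_iff:
  assumes G: "G \<in> carrier_mat p n" and H: "H \<in> carrier_mat q m"
  shows "cker (kronecker (transpose_mat G) H) = {0\<^sub>v (p * m)} \<longleftrightarrow>
    (\<forall>X \<in> carrier_mat m p. H * map_mat rf_const X * G = 0\<^sub>m q n \<longrightarrow> X = 0\<^sub>m m p)"
proof -
  have in_cker: "vectorize X \<in> cker (kronecker (transpose_mat G) H) \<longleftrightarrow> H * map_mat rf_const X * G = 0\<^sub>m q n"
    if X: "X \<in> carrier_mat m p" for X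
  proof -
    have "map_vec rf_const (vectorize X) = vectorize (map_mat rf_const X)"
      using X by (auto simp: vectorize_def less_mult_imp_div_less mod_less_of_less_mult intro!: eq_vecI)
    moreover have "H * map_mat rf_const X * G \<in> carrier_mat q n"
      using G H X by (intro mult_carrier_mat) auto
    moreover have "kronecker (transpose_mat G) H *\<^sub>v vectorize (map_mat rf_const X) =
        vectorize (H * map_mat rf_const X * G)"
      by (rule kronecker_transpose_mult_vectorize[OF H _ G]) (use X in auto)
    moreover have "vectorize X \<in> carrier_vec (p * m)" "dim_row (kronecker (transpose_mat G) H) = n * q"
      "dim_col (kronecker (transpose_mat G) H) = p * m"
      using X G H by (simp_all add: vectorize_def kronecker_def)
    ultimately show ?thesis
      using vectorize_eq_0_iff[of "H * map_mat rf_const X * G" q n] by (simp add: cker_def)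
  qed
  have dim: "cker (kronecker (transpose_mat G) H) \<subseteq> carrier_vec (p * m)"
    using G H by (auto simp: cker_def kronecker_def)
  have "vectorize (0\<^sub>m m p) \<in> cker (kronecker (transpose_mat G) H)"
  proof (subst in_cker)
    have "map_mat rf_const (0\<^sub>m m p) = 0\<^sub>m m p"
      by (intro eq_matI) auto
    then show "H * map_mat rf_const (0\<^sub>m m p) * G = 0\<^sub>m q n"
      using G H by simp
  qed simp
  then have 0: "0\<^sub>v (p * m) \<in> cker (kronecker (transpose_mat G) H)"
    using vectorize_eq_0_iff[of "0\<^sub>m m p :: real mat" m p] by simp
  show ?thesis
  proof
    assume "cker (kronecker (transpose_mat G) H) = {0\<^sub>v (p * m)}"
    then show "\<forall>X \<in> carrier_mat m p. H * map_mat rf_const X * G = 0\<^sub>m q n \<longrightarrow> X = 0\<^sub>m m p"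
      using in_cker vectorize_eq_0_iff by blast
  next
    assume triv: "\<forall>X \<in> carrier_mat m p. H * map_mat rf_const X * G = 0\<^sub>m q n \<longrightarrow> X = 0\<^sub>m m p"
    have "w = 0\<^sub>v (p * m)" if w: "w \<in> cker (kronecker (transpose_mat G) H)" for w
    proof -
      obtain X where X: "X \<in> carrier_mat m p" "w = vectorize X"
        using vectorize_surj[OF subsetD[OF dim w]] .
      then have "H * map_mat rf_const X * G = 0\<^sub>m q n"
        using in_cker[OF X(1)] w by simp
      then show ?thesis
        using triv X vectorize_eq_0_iff[OF X(1)] by simp
    qed
    then show "cker (kronecker (transpose_mat G) H) = {0\<^sub>v (p * m)}"
      using 0 by blast
  qed
qed

section \<open>Indistinguishability in terms of Markov parameters\<close>

lemma net_state_carrier: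
  assumes "A + B * Q * C \<in> carrier_mat n n" "B * R \<in> carrier_mat n m" "x0 \<in> carrier_vec n"
    "\<And>t. u t \<in> carrier_vec m"
  shows "net_state A B C R u x0 Q t \<in> carrier_vec n"
  using assms by (induction t) auto

text \<open>
  The impulse acts at time \<open>0\<close> and reaches the state one step later, hence the power \<open>T\<^sup>t\<close> at time
  \<open>t + 1\<close>.
\<close>

lemma net_state_impulse:
  assumes T_def: "T = A + B * Q * C" and W_def: "W = B * R"
    and T: "T \<in> carrier_mat n n" and W: "W \<in> carrier_mat n m"
    and x0: "x0 \<in> carrier_vec n" and v: "v \<in> carrier_vec m"
  shows "net_state A B C R (\<lambda>t. if t = 0 then v else 0\<^sub>v m) x0 Q (Suc t) =
    T ^\<^sub>m Suc t *\<^sub>v x0 + (T ^\<^sub>m t * W) *\<^sub>v v"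
proof (induction t)
  case 0
  show ?case
    using T W by (simp add: left_mult_one_mat[OF W] flip: T_def W_def)
next
  case (Suc t)
  note comm = pow_mat_Suc_left[OF T, symmetric]
  have Tt: "T ^\<^sub>m Suc t \<in> carrier_mat n n" "T ^\<^sub>m t \<in> carrier_mat n n" "T ^\<^sub>m t * W \<in> carrier_mat n m"
    using T W by (auto simp del: pow_mat.simps intro: mult_carrier_mat)
  have "T *\<^sub>v (T ^\<^sub>m Suc t *\<^sub>v x0 + (T ^\<^sub>m t * W) *\<^sub>v v) =
      T *\<^sub>v (T ^\<^sub>m Suc t *\<^sub>v x0) + T *\<^sub>v ((T ^\<^sub>m t * W) *\<^sub>v v)"
    using mult_mat_vec_carrier[OF Tt(1) x0] mult_mat_vec_carrier[OF Tt(3) v]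
    by (rule mult_add_distrib_mat_vec[OF T])
  also have "\<dots> = (T * T ^\<^sub>m Suc t) *\<^sub>v x0 + (T * (T ^\<^sub>m t * W)) *\<^sub>v v"
    using assoc_mult_mat_vec[OF T Tt(1) x0] assoc_mult_mat_vec[OF T Tt(3) v] by simp
  also have "T * (T ^\<^sub>m t * W) = T ^\<^sub>m Suc t * W"
    using assoc_mult_mat[OF T Tt(2) W] comm by simp
  finally have "T *\<^sub>v (T ^\<^sub>m Suc t *\<^sub>v x0 + (T ^\<^sub>m t * W) *\<^sub>v v) =
      T ^\<^sub>m Suc (Suc t) *\<^sub>v x0 + (T ^\<^sub>m Suc t * W) *\<^sub>v v"
    unfolding comm .
  moreover have "T ^\<^sub>m Suc (Suc t) *\<^sub>v x0 + (T ^\<^sub>m Suc t * W) *\<^sub>v v \<in> carrier_vec n"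
    using T W x0 v by (auto simp del: pow_mat.simps intro!: add_carrier_vec mult_mat_vec_carrier mult_carrier_mat)
  ultimately show ?case
    unfolding net_state.simps(2)[of _ _ _ _ _ _ _ "Suc t"] Suc
    by (simp add: mult_mat_zero_vec[OF W] del: pow_mat.simps flip: T_def W_def)
qed

text \<open>
  If the networks are indistinguishable for some initial states, then the responses to an impulse in
  direction \<open>v\<close> agree; subtracting the responses for \<open>v = 0\<close> removes the unknown initial states and
  leaves the Markov parameters applied to \<open>v\<close>. Conversely, with equal Markov parameters the initial
  states can both be taken to be zero.
\<close>

lemma indistinguishable_iff_markov_eq:
  fixes A B C R S Q Q' :: "real mat"
  assumes A: "A \<in> carrier_mat n n" and B: "B \<in> carrier_mat n q" and C: "C \<in> carrier_mat p n"
    and R: "R \<in> carrier_mat q m" and S: "S \<in> carrier_mat s p"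
    and Q: "Q \<in> carrier_mat q p" and Q': "Q' \<in> carrier_mat q p"
  shows "indistinguishable A B C R S Q Q' \<longleftrightarrow>
    (\<forall>k. S * C * (A + B * Q * C) ^\<^sub>m k * (B * R) = S * C * (A + B * Q' * C) ^\<^sub>m k * (B * R))"
proof -
  define P T T' W where P_def: "P = S * C" and T_def: "T = A + B * Q * C" and T'_def: "T' = A + B * Q' * C"
    and W_def: "W = B * R"
  have P: "P \<in> carrier_mat s n" and T: "T \<in> carrier_mat n n" and T': "T' \<in> carrier_mat n n"
    and W: "W \<in> carrier_mat n m"
    using assms by (auto simp: P_def T_def T'_def W_def)
  have dims: "dim_row A = n" "dim_col R = m"
    using A R by auto
  have PTk: "P * X ^\<^sub>m k \<in> carrier_mat s n" if "X \<in> carrier_mat n n" for X k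
    using P that by simp
  have "indistinguishable A B C R S Q Q' \<longleftrightarrow> (\<forall>k. P * T ^\<^sub>m k * W = P * T' ^\<^sub>m k * W)"
  proof
    assume "indistinguishable A B C R S Q Q'"
    then obtain x0 x0' where x0: "x0 \<in> carrier_vec n" and x0': "x0' \<in> carrier_vec n"
      and out: "\<And>u t. (\<And>t. u t \<in> carrier_vec m) \<Longrightarrow>
        P *\<^sub>v net_state A B C R u x0 Q t = P *\<^sub>v net_state A B C R u x0' Q' t"
      unfolding indistinguishable_def dims net_output_def P_def by (metis (no_types, lifting))
    have impulse: "(P * X ^\<^sub>m Suc k) *\<^sub>v x + (P * X ^\<^sub>m k * W) *\<^sub>v v =
        P *\<^sub>v (X ^\<^sub>m Suc k *\<^sub>v x + (X ^\<^sub>m k * W) *\<^sub>v v)"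
      if "X \<in> carrier_mat n n" "x \<in> carrier_vec n" "v \<in> carrier_vec m" for X x v k
    proof -
      have Xk: "X ^\<^sub>m Suc k \<in> carrier_mat n n" "X ^\<^sub>m k \<in> carrier_mat n n" "X ^\<^sub>m k * W \<in> carrier_mat n m"
        using that(1) W by (auto simp del: pow_mat.simps intro: mult_carrier_mat)
      have "P *\<^sub>v (X ^\<^sub>m Suc k *\<^sub>v x + (X ^\<^sub>m k * W) *\<^sub>v v) =
          P *\<^sub>v (X ^\<^sub>m Suc k *\<^sub>v x) + P *\<^sub>v ((X ^\<^sub>m k * W) *\<^sub>v v)"
        using mult_mat_vec_carrier[OF Xk(1) that(2)] mult_mat_vec_carrier[OF Xk(3) that(3)]
        by (rule mult_add_distrib_mat_vec[OF P])
      also have "\<dots> = (P * X ^\<^sub>m Suc k) *\<^sub>v x + (P * (X ^\<^sub>m k * W)) *\<^sub>v v"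
        using assoc_mult_mat_vec[OF P Xk(1) that(2)] assoc_mult_mat_vec[OF P Xk(3) that(3)] by simp
      also have "P * (X ^\<^sub>m k * W) = P * X ^\<^sub>m k * W"
        using assoc_mult_mat[OF P Xk(2) W] by simp
      finally show ?thesis ..
    qed
    have out_impulse: "(P * T ^\<^sub>m Suc k) *\<^sub>v x0 + (P * T ^\<^sub>m k * W) *\<^sub>v v =
        (P * T' ^\<^sub>m Suc k) *\<^sub>v x0' + (P * T' ^\<^sub>m k * W) *\<^sub>v v"
      if v: "v \<in> carrier_vec m" for v k
      using out[of "\<lambda>t. if t = 0 then v else 0\<^sub>v m" "Suc k"] v
      unfolding net_state_impulse[OF T_def W_def T W x0 v] net_state_impulse[OF T'_def W_def T' W x0' v]
        impulse[OF T x0 v] impulse[OF T' x0' v] by simp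
    show "\<forall>k. P * T ^\<^sub>m k * W = P * T' ^\<^sub>m k * W"
    proof
      fix k
      have PTW: "P * T ^\<^sub>m k * W \<in> carrier_mat s m" "P * T' ^\<^sub>m k * W \<in> carrier_mat s m"
        using PTk[OF T] PTk[OF T'] W by (meson mult_carrier_mat)+
      have zero: "X *\<^sub>v 0\<^sub>v m = 0\<^sub>v s" if "X \<in> carrier_mat s m" for X :: "real mat"
        by (rule mult_mat_zero_vec[OF that])
      have a: "(P * X ^\<^sub>m Suc k) *\<^sub>v x \<in> carrier_vec s" if "X \<in> carrier_mat n n" for X x
        using mult_carrier_mat[OF P pow_carrier_mat[OF that, of "Suc k"]] by (metis carrier_matD(1) carrier_vec_dim_vec dim_mult_mat_vec)
      have free: "(P * T ^\<^sub>m Suc k) *\<^sub>v x0 = (P * T' ^\<^sub>m Suc k) *\<^sub>v x0'"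
        using out_impulse[OF zero_carrier_vec, of k] a[OF T] a[OF T']
        unfolding zero[OF PTW(1)] zero[OF PTW(2)] by (metis right_zero_vec)
      show "P * T ^\<^sub>m k * W = P * T' ^\<^sub>m k * W"
      proof (rule eq_mat_if_mult_vec_eq[OF PTW])
        fix v :: "real vec" assume v: "v \<in> carrier_vec m"
        let ?a = "(P * T' ^\<^sub>m Suc k) *\<^sub>v x0'"
        have "?a + (P * T ^\<^sub>m k * W) *\<^sub>v v = ?a + (P * T' ^\<^sub>m k * W) *\<^sub>v v"
          using out_impulse[OF v, of k] unfolding free .
        moreover have "(P * T ^\<^sub>m k * W) *\<^sub>v v \<in> carrier_vec s" "(P * T' ^\<^sub>m k * W) *\<^sub>v v \<in> carrier_vec s"
          using PTW v by (meson mult_mat_vec_carrier)+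
        ultimately show "(P * T ^\<^sub>m k * W) *\<^sub>v v = (P * T' ^\<^sub>m k * W) *\<^sub>v v"
          by (rule vec_add_left_imp_eq)
      qed
    qed
  next
    assume markov: "\<forall>k. P * T ^\<^sub>m k * W = P * T' ^\<^sub>m k * W"
    have "P *\<^sub>v net_state A B C R u (0\<^sub>v n) Q t = P *\<^sub>v net_state A B C R u (0\<^sub>v n) Q' t"
      if u: "\<And>t. u t \<in> carrier_vec m" for u t
    proof -
      let ?x = "net_state A B C R u (0\<^sub>v n) Q" and ?x' = "net_state A B C R u (0\<^sub>v n) Q'"
      have x: "?x t \<in> carrier_vec n" "?x' t \<in> carrier_vec n" for t
        using net_state_carrier T T' W u unfolding T_def T'_def W_def by (meson zero_carrier_vec)+
      have step: "(P * X ^\<^sub>m k) *\<^sub>v (X *\<^sub>v y + W *\<^sub>v v) = (P * X ^\<^sub>m Suc k) *\<^sub>v y + (P * X ^\<^sub>m k * W) *\<^sub>v v"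
        if X: "X \<in> carrier_mat n n" and y: "y \<in> carrier_vec n" and v: "v \<in> carrier_vec m" for X y v k
      proof -
        have "(P * X ^\<^sub>m k) *\<^sub>v (X *\<^sub>v y + W *\<^sub>v v) = (P * X ^\<^sub>m k) *\<^sub>v (X *\<^sub>v y) + (P * X ^\<^sub>m k) *\<^sub>v (W *\<^sub>v v)"
          using mult_mat_vec_carrier[OF X y] mult_mat_vec_carrier[OF W v]
          by (rule mult_add_distrib_mat_vec[OF PTk[OF X]])
        also have "\<dots> = (P * X ^\<^sub>m k * X) *\<^sub>v y + (P * X ^\<^sub>m k * W) *\<^sub>v v"
          using assoc_mult_mat_vec[OF PTk[OF X] X y] assoc_mult_mat_vec[OF PTk[OF X] W v] by simp
        also have "P * X ^\<^sub>m k * X = P * X ^\<^sub>m Suc k"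
          using assoc_mult_mat[OF P pow_carrier_mat[OF X] X] by simp
        finally show ?thesis .
      qed
      \<comment> \<open>The output, which is the case \<open>k = 0\<close>, is not preserved by the induction on its own: a step of the
        dynamics raises the power of the state matrix.\<close>
      have "(P * T ^\<^sub>m k) *\<^sub>v ?x t = (P * T' ^\<^sub>m k) *\<^sub>v ?x' t" for k
      proof (induction t arbitrary: k)
        case 0
        then show ?case
          by (simp add: mult_mat_zero_vec[OF PTk[OF T]] mult_mat_zero_vec[OF PTk[OF T']])
      next
        case (Suc t)
        show ?case
          using step[OF T x(1) u] step[OF T' x(2) u] Suc[of "Suc k"] markov
          by (simp flip: T_def T'_def W_def del: pow_mat.simps)
      qed
      from this[of 0] show ?thesis
        using P T T' by (simp add: right_mult_one_mat)
    qed
    then have "\<forall>u. (\<forall>t. u t \<in> carrier_vec m) \<longrightarrow>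
        net_output A B C R S u (0\<^sub>v n) Q = net_output A B C R S u (0\<^sub>v n) Q'"
      unfolding net_output_def P_def by blast
    then show "indistinguishable A B C R S Q Q'"
      unfolding indistinguishable_def dims by (meson zero_carrier_vec)
  qed
  then show ?thesis
    by (simp add: P_def T_def T'_def W_def)
qed

section \<open>Cancelling matrices of full rank\<close>

text \<open>
  Linear independence of the columns is expressed through the set of columns, so equal columns have
  to be excluded first: a set with fewer than \<open>c\<close> elements cannot have rank \<open>c\<close>.
\<close>

lemma full_col_rank_mult_eq_0:
  assumes S: "S \<in> carrier_mat r c" and rank: "full_col_rank S"
    and v: "v \<in> carrier_vec c" "S *\<^sub>v v = 0\<^sub>v r"
  shows "v = 0\<^sub>v c"
proof (rule ccontr)
  assume "v \<noteq> 0\<^sub>v c"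
  interpret vec_space "TYPE(real)" r .
  have full: "rank S = c"
    using rank S by (simp add: full_col_rank_def)
  have "distinct (cols S)"
  proof (rule ccontr)
    assume "\<not> distinct (cols S)"
    then have "card (set (cols S)) < c"
      using S card_distinct card_length by (metis carrier_matD(2) cols_length le_neq_implies_less)
    moreover obtain U where "maximal U (\<lambda>T. T \<subseteq> set (cols S) \<and> lin_indpt T)"
      using maximal_exists[of "(\<lambda>T. T \<subseteq> set (cols S) \<and> lin_indpt T)" "card (set (cols S))" "{}"]
      by (meson List.finite_set card_mono empty_iff empty_subsetI finite_lin_indpt2 rev_finite_subset)
    ultimately show False
      using rank_card_indpt[OF S] full card_mono[OF List.finite_set[of "cols S"]]
      by (metis (no_types, lifting) linorder_not_le maximal_def)
  qed
  then show False
    using lin_depI[OF S v(1) \<open>v \<noteq> 0\<^sub>v c\<close> v(2)] full_rank_lin_indpt[OF S full] by blast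
qed

lemma full_col_rank_cancel_left:
  assumes S: "S \<in> carrier_mat r c" and rank: "full_col_rank S"
    and X: "X \<in> carrier_mat c k" and Y: "Y \<in> carrier_mat c k" and eq: "S * X = S * Y"
  shows "X = Y"
proof (rule eq_matI)
  fix i j assume ij: "i < dim_row Y" "j < dim_col Y"
  have "S *\<^sub>v (col X j - col Y j) = S *\<^sub>v col X j - S *\<^sub>v col Y j"
    using S X Y ij by (intro mult_minus_distrib_mat_vec[of _ r c]) auto
  also have "\<dots> = 0\<^sub>v r"
  proof -
    have "S *\<^sub>v col X j = S *\<^sub>v col Y j"
      using eq X Y ij by (metis S carrier_matD(2) col_mult2)
    then show ?thesis
      using S by auto
  qed
  finally have "col X j - col Y j = 0\<^sub>v c"
    using X Y ij by (intro full_col_rank_mult_eq_0[OF S rank]) auto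
  then have "(col X j - col Y j) $ i = 0"
    using Y ij by simp
  then show "X $$ (i, j) = Y $$ (i, j)"
    using X Y ij by simp
qed (use X Y in auto)

text \<open>
  A maximal independent set of columns of \<open>R\<close> has \<open>r\<close> elements and thus forms an invertible matrix,
  which can be cancelled.
\<close>

lemma full_row_rank_cancel_right:
  assumes R: "R \<in> carrier_mat r c" and rank: "full_row_rank R"
    and X: "X \<in> carrier_mat k r" and Y: "Y \<in> carrier_mat k r" and eq: "X * R = Y * R"
  shows "X = Y"
proof -
  interpret vec_space "TYPE(real)" r .
  have full: "rank R = r"
    using rank R by (simp add: full_row_rank_def)
  obtain U where U: "maximal U (\<lambda>T. T \<subseteq> set (cols R) \<and> lin_indpt T)"
    using maximal_exists[of "(\<lambda>T. T \<subseteq> set (cols R) \<and> lin_indpt T)" "card (set (cols R))" "{}"]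
    by (meson List.finite_set card_mono empty_iff empty_subsetI finite_lin_indpt2 rev_finite_subset)
  then have card: "card U = r" and sub: "U \<subseteq> set (cols R)" and indpt: "lin_indpt U"
    using rank_card_indpt[OF R U] full by (auto simp: maximal_def)
  obtain us where us: "set us = U" "distinct us" "length us = r"
    using finite_distinct_list[of U] sub card by (metis List.finite_set distinct_card finite_subset)
  have vecs: "U \<subseteq> carrier_vec r"
    using sub cols_dim R by (metis carrier_matD(1) order_trans)
  let ?B = "mat_of_cols r us"
  have B: "?B \<in> carrier_mat r r"
    using us by auto
  have cols: "cols ?B = us"
    using vecs us by (simp add: cols_mat_of_cols)
  have "rank ?B = r"
    using lin_indpt_full_rank[OF B] cols us indpt by simp
  then have "det ?B \<noteq> 0"
    using det_rank_iff[OF B] by simp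
  then obtain B' where B': "B' \<in> carrier_mat r r" "?B * B' = 1\<^sub>m r"
    using det_non_zero_imp_unit[OF B, of "()"] by (auto simp: Units_def ring_mat_def)
  have "X * ?B = Y * ?B"
  proof (rule mat_col_eqI)
    fix j assume "j < dim_col (Y * ?B)"
    then have j: "j < r"
      using us by simp
    then have "us ! j \<in> set (cols R)"
      using sub us by (metis nth_mem subsetD)
    then obtain l where l: "l < c" "us ! j = col R l"
      using R by (auto simp: cols_def)
    have "col ?B j = col R l"
      using j l us vecs by (metis col_mat_of_cols nth_mem subsetD)
    then show "col (X * ?B) j = col (Y * ?B) j"
      using arg_cong[OF eq, of "\<lambda>M. col M l"] X Y R l(1) B j us by simp
  qed (use X Y in auto)
  then have "X * ?B * B' = Y * ?B * B'"
    by simp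
  then show ?thesis
    using X Y B B' by (simp add: assoc_mult_mat[of _ k r _ r _ r])
qed

section \<open>Identifiability of the topology\<close>

lemma transfer_eq_imp_indistinguishable:
  fixes A B C R S Q Q' :: "real mat"
  assumes A: "A \<in> carrier_mat n n" and B: "B \<in> carrier_mat n q" and C: "C \<in> carrier_mat p n"
    and R: "R \<in> carrier_mat q m" and S: "S \<in> carrier_mat s p"
    and Q: "Q \<in> carrier_mat q p" and Q': "Q' \<in> carrier_mat q p"
    and eq: "transfer_mat (A + B * Q * C) B C = transfer_mat (A + B * Q' * C) B C"
  shows "indistinguishable A B C R S Q Q'"
  unfolding indistinguishable_iff_markov_eq[OF A B C R S Q Q']
proof
  fix k
  have T: "A + B * Q * C \<in> carrier_mat n n" "A + B * Q' * C \<in> carrier_mat n n"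
    using A B C Q Q' by auto
  have assoc: "S * C * X * (B * R) = S * (C * X * B) * R" if "X \<in> carrier_mat n n" for X
  proof -
    have "dim_col S = p" "dim_row C = p" "dim_col C = n" "dim_row X = n" "dim_col X = n" "dim_row B = n"
      "dim_col B = q" "dim_row R = q"
      using assms that by auto
    then show ?thesis
      by (simp add: assoc_mult_mat_dim del: assoc_mult_mat)
  qed
  show "S * C * (A + B * Q * C) ^\<^sub>m k * (B * R) = S * C * (A + B * Q' * C) ^\<^sub>m k * (B * R)"
    using eq unfolding transfer_mat_eq_iff_markov_eq[OF C T B]
      assoc[OF pow_carrier_mat[OF T(1)]] assoc[OF pow_carrier_mat[OF T(2)]] by simp
qed

lemma indistinguishable_imp_transfer_eq:
  fixes A B C R S Q Q' :: "real mat"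
  assumes A: "A \<in> carrier_mat n n" and B: "B \<in> carrier_mat n q" and C: "C \<in> carrier_mat p n"
    and R: "R \<in> carrier_mat q m" and S: "S \<in> carrier_mat s p"
    and Q: "Q \<in> carrier_mat q p" and Q': "Q' \<in> carrier_mat q p"
    and rank: "full_col_rank S" "full_row_rank R"
    and indist: "indistinguishable A B C R S Q Q'"
  shows "transfer_mat (A + B * Q * C) B C = transfer_mat (A + B * Q' * C) B C"
proof -
  have T: "A + B * Q * C \<in> carrier_mat n n" "A + B * Q' * C \<in> carrier_mat n n"
    using A B C Q Q' by auto
  have assoc: "S * C * X * (B * R) = S * (C * X * B * R)" if "X \<in> carrier_mat n n" for X
  proof -
    have "dim_col S = p" "dim_row C = p" "dim_col C = n" "dim_row X = n" "dim_col X = n" "dim_row B = n"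
      "dim_col B = q" "dim_row R = q"
      using assms that by auto
    then show ?thesis
      by (simp add: assoc_mult_mat_dim del: assoc_mult_mat)
  qed
  have CXB: "C * X * B \<in> carrier_mat p q" if "X \<in> carrier_mat n n" for X
    using B C that by (meson mult_carrier_mat)
  show ?thesis
    unfolding transfer_mat_eq_iff_markov_eq[OF C T B]
  proof
    fix k
    note Tk = pow_carrier_mat[OF T(1), of k] pow_carrier_mat[OF T(2), of k]
    have "S * (C * (A + B * Q * C) ^\<^sub>m k * B * R) = S * (C * (A + B * Q' * C) ^\<^sub>m k * B * R)"
      using indist unfolding indistinguishable_iff_markov_eq[OF A B C R S Q Q'] assoc[OF Tk(1)] assoc[OF Tk(2)]
      using Tk assoc by metis
    then have "C * (A + B * Q * C) ^\<^sub>m k * B * R = C * (A + B * Q' * C) ^\<^sub>m k * B * R"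
      by (rule full_col_rank_cancel_left[OF S rank(1) mult_carrier_mat[OF CXB[OF Tk(1)] R]
            mult_carrier_mat[OF CXB[OF Tk(2)] R]])
    then show "C * (A + B * Q * C) ^\<^sub>m k * B = C * (A + B * Q' * C) ^\<^sub>m k * B"
      by (rule full_row_rank_cancel_right[OF R rank(2) CXB[OF Tk(1)] CXB[OF Tk(2)]])
  qed
qed

theorem theorem3:
  fixes N m p :: nat
    and nd md pd :: "nat \<Rightarrow> nat"
    and A B C R S :: "nat \<Rightarrow> real mat"
    and Q :: "nat \<Rightarrow> nat \<Rightarrow> real mat"
  assumes "N \<ge> 1"
    and "\<And>i. i < N \<Longrightarrow> A i \<in> carrier_mat (nd i) (nd i)"
    and "\<And>i. i < N \<Longrightarrow> B i \<in> carrier_mat (nd i) (md i)"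
    and "\<And>i. i < N \<Longrightarrow> C i \<in> carrier_mat (pd i) (nd i)"
    and "\<And>i. i < N \<Longrightarrow> R i \<in> carrier_mat (md i) m"
    and "\<And>i. i < N \<Longrightarrow> S i \<in> carrier_mat p (pd i)"
    and "\<And>i j. i < N \<Longrightarrow> j < N \<Longrightarrow> Q i j \<in> carrier_mat (md i) (pd j)"
  defines "G \<equiv> \<lambda>i. transfer_mat (A i) (B i) (C i)"
    and "RR \<equiv> block_col m N R"
    and "SS \<equiv> block_row p N S"
  defines "identifiable \<equiv>
      topology_identifiable (block_diag N A) (block_diag N B) (block_diag N C) RR SS
        (block_mat N md pd Q)"
    and "kernel_condition \<equiv>
      \<forall>i<N. \<forall>j<N. cker (kronecker (transpose_mat (G i)) (G j)) = {0\<^sub>v (pd i * md j)}"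
  shows "(identifiable \<longrightarrow> kernel_condition) \<and>
    (full_col_rank SS \<and> full_row_rank RR \<longrightarrow> (identifiable \<longleftrightarrow> kernel_condition))"
proof -
  let ?c = "map_mat rf_const"
  define nn mm pp where "nn = (\<Sum>k<N. nd k)" and "mm = (\<Sum>k<N. md k)" and "pp = (\<Sum>k<N. pd k)"
  define AA BB CC QQ where "AA = block_diag N A" and "BB = block_diag N B" and "CC = block_diag N C"
    and "QQ = block_mat N md pd Q"
  define GG where "GG = transfer_mat AA BB CC"
  define U V where "U = (block_embedding N md :: nat \<Rightarrow> real mat)"
    and "V = (block_embedding N pd :: nat \<Rightarrow> real mat)"
  have AA: "AA \<in> carrier_mat nn nn" and BB: "BB \<in> carrier_mat nn mm" and CC: "CC \<in> carrier_mat pp nn"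
    and RR: "RR \<in> carrier_mat mm m" and SS: "SS \<in> carrier_mat p pp" and QQ: "QQ \<in> carrier_mat mm pp"
    unfolding AA_def BB_def CC_def RR_def SS_def QQ_def nn_def mm_def pp_def
    using assms(2-7) by (auto intro!: block_diag_carrier block_col_carrier block_row_carrier block_mat_carrier)
  have U: "U i \<in> carrier_mat mm (md i)" and V: "V i \<in> carrier_mat pp (pd i)" for i
    by (simp_all add: U_def V_def mm_def pp_def)
  have GG: "GG \<in> carrier_mat pp mm"
    unfolding GG_def by (rule transfer_mat_carrier[OF CC AA BB])
  have G: "G i \<in> carrier_mat (pd i) (md i)" if "i < N" for i
    unfolding G_def using assms(2-4) that by (intro transfer_mat_carrier) auto
  have GG_U: "GG * ?c (U i) = ?c (V i) * G i"
    and G_U: "G i * ?c (transpose_mat (U i)) = ?c (transpose_mat (V i)) * GG" if "i < N" for i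
    unfolding GG_def G_def AA_def BB_def CC_def U_def V_def
    using transfer_mat_block_diag[where N = N and A = A and B = B and C = C and nd = nd and md = md and pd = pd]
      assms(2-4) that by blast+
  have identifiable_iff: "identifiable \<longleftrightarrow>
      (\<forall>Q' \<in> carrier_mat mm pp. Q' \<noteq> QQ \<longrightarrow> \<not> indistinguishable AA BB CC RR SS QQ Q')"
    using QQ by (simp add: identifiable_def topology_identifiable_def AA_def BB_def CC_def QQ_def)
  have kernel_iff: "kernel_condition \<longleftrightarrow> (\<forall>i<N. \<forall>j<N. \<forall>X \<in> carrier_mat (md j) (pd i).
      G j * ?c X * G i = 0\<^sub>m (pd j) (md i) \<longrightarrow> X = 0\<^sub>m (md j) (pd i))"
    unfolding kernel_condition_def
    by (intro all_cong imp_cong refl cker_kronecker_trivial_iff G)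
  have transfer_iff: "transfer_mat (AA + BB * QQ * CC) BB CC = transfer_mat (AA + BB * Q' * CC) BB CC \<longleftrightarrow>
      GG * ?c (QQ - Q') * GG = 0\<^sub>m pp mm" if "Q' \<in> carrier_mat mm pp" for Q'
    unfolding GG_def by (rule transfer_mat_feedback_eq_iff[OF AA BB CC QQ that])
  have "kernel_condition" if "identifiable"
    unfolding kernel_iff
  proof (intro allI impI ballI)
    fix i j X
    assume "i < N" "j < N" and X: "X \<in> carrier_mat (md j) (pd i)"
      and GXG: "G j * ?c X * G i = 0\<^sub>m (pd j) (md i)"
    \<comment> \<open>A nontrivial element \<open>X\<close> of the kernel yields a perturbation of the interconnection from node \<open>i\<close> to
      node \<open>j\<close> that cannot be seen from outside.\<close>
    define D where "D = U j * X * transpose_mat (V i)"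
    have D: "D \<in> carrier_mat mm pp"
      unfolding D_def using U[of j] V[of i] X by auto
    have cD: "?c D = ?c (U j) * ?c X * ?c (transpose_mat (V i))"
      unfolding D_def using U[of j] V[of i] X
      by (subst rf_const_hom.mat_hom_mult[of _ mm "pd i" _ pp] rf_const_hom.mat_hom_mult[of _ mm "md j" _ "pd i"]; auto)+
    have dims: "dim_row (U j) = mm" "dim_col (U j) = md j" "dim_row (V i) = pp" "dim_col (V i) = pd i"
      "dim_row (V j) = pp" "dim_col (V j) = pd j" "dim_row (U i) = mm" "dim_col (U i) = md i"
      "dim_row X = md j" "dim_col X = pd i" "dim_row GG = pp" "dim_col GG = mm"
      "dim_row (G j) = pd j" "dim_col (G j) = md j" "dim_row (G i) = pd i" "dim_col (G i) = md i"
      using U[of i] U[of j] V[of i] V[of j] X GG G[OF \<open>i < N\<close>] G[OF \<open>j < N\<close>] by auto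
    have "GG * ?c D * GG = (GG * ?c (U j)) * ?c X * (?c (transpose_mat (V i)) * GG)"
      unfolding cD by (simp add: assoc_mult_mat_dim dims del: assoc_mult_mat)
    also have "\<dots> = ?c (V j) * (G j * ?c X * G i) * ?c (transpose_mat (U i))"
      unfolding GG_U[OF \<open>j < N\<close>] G_U[OF \<open>i < N\<close>, symmetric]
      by (simp add: assoc_mult_mat_dim dims del: assoc_mult_mat)
    also have "\<dots> = 0\<^sub>m pp mm"
      unfolding GXG using V[of j] U[of i] by simp
    finally have GDG: "GG * ?c D * GG = 0\<^sub>m pp mm" .
    define Q' where "Q' = QQ - D"
    have Q': "Q' \<in> carrier_mat mm pp" and diff: "QQ - Q' = D"
      using QQ D unfolding Q'_def by (auto intro!: eq_matI)
    have "transfer_mat (AA + BB * QQ * CC) BB CC = transfer_mat (AA + BB * Q' * CC) BB CC"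
      unfolding transfer_iff[OF Q'] diff by (rule GDG)
    then have "indistinguishable AA BB CC RR SS QQ Q'"
      by (rule transfer_eq_imp_indistinguishable[OF AA BB CC RR SS QQ Q'])
    then have "Q' = QQ"
      using that Q' unfolding identifiable_iff by blast
    then have D0: "D = 0\<^sub>m mm pp"
      using diff QQ by auto
    \<comment> \<open>Inclusions followed by their projections are identities, so \<open>X\<close> is recovered from \<open>D\<close>.\<close>
    have "X = transpose_mat (U j) * U j * X * (transpose_mat (V i) * V i)"
      using X unfolding U_def V_def transpose_block_embedding_mult_self[OF \<open>i < N\<close>]
        transpose_block_embedding_mult_self[OF \<open>j < N\<close>] by simp
    also have "\<dots> = transpose_mat (U j) * D * V i"
      unfolding D_def by (simp add: assoc_mult_mat_dim dims del: assoc_mult_mat)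
    also have "\<dots> = 0\<^sub>m (md j) (pd i)"
      unfolding D0 using U[of j] V[of i] by simp
    finally show "X = 0\<^sub>m (md j) (pd i)" .
  qed
  moreover have "identifiable" if "full_col_rank SS" "full_row_rank RR" "kernel_condition"
    unfolding identifiable_iff
  proof (intro ballI impI notI)
    fix Q' assume Q': "Q' \<in> carrier_mat mm pp" and "Q' \<noteq> QQ" and "indistinguishable AA BB CC RR SS QQ Q'"
    then have "transfer_mat (AA + BB * QQ * CC) BB CC = transfer_mat (AA + BB * Q' * CC) BB CC"
      using that by (intro indistinguishable_imp_transfer_eq[OF AA BB CC RR SS QQ Q'])
    then have GDG: "GG * ?c (QQ - Q') * GG = 0\<^sub>m pp mm"
      unfolding transfer_iff[OF Q'] .
    define D where "D = QQ - Q'"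
    have D: "D \<in> carrier_mat mm pp"
      unfolding D_def using Q' by (rule minus_carrier_mat)
    have "D = 0\<^sub>m mm pp"
      unfolding mm_def pp_def
    proof (rule eq_mat_if_blocks_eq)
      fix j i assume "j < N" "i < N"
      let ?X = "transpose_mat (U j) * D * V i"
      have X: "?X \<in> carrier_mat (md j) (pd i)"
        using U[of j] V[of i] D by auto
      have cX: "?c ?X = ?c (transpose_mat (U j)) * ?c D * ?c (V i)"
        using U[of j] V[of i] D
        by (subst rf_const_hom.mat_hom_mult[of _ "md j" pp _ "pd i"] rf_const_hom.mat_hom_mult[of _ "md j" mm _ pp]; auto)+
      have dims: "dim_row (U j) = mm" "dim_col (U j) = md j" "dim_row (V i) = pp" "dim_col (V i) = pd i"
        "dim_row (V j) = pp" "dim_col (V j) = pd j" "dim_row (U i) = mm" "dim_col (U i) = md i"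
        "dim_row D = mm" "dim_col D = pp" "dim_row GG = pp" "dim_col GG = mm"
        "dim_row (G j) = pd j" "dim_col (G j) = md j" "dim_row (G i) = pd i" "dim_col (G i) = md i"
        using U[of i] U[of j] V[of i] V[of j] D GG G[OF \<open>i < N\<close>] G[OF \<open>j < N\<close>] by auto
      have "G j * ?c ?X * G i = (G j * ?c (transpose_mat (U j))) * ?c D * (?c (V i) * G i)"
        unfolding cX by (simp add: assoc_mult_mat_dim dims del: assoc_mult_mat)
      also have "\<dots> = ?c (transpose_mat (V j)) * (GG * ?c D * GG) * ?c (U i)"
        unfolding GG_U[OF \<open>i < N\<close>, symmetric] G_U[OF \<open>j < N\<close>]
        by (simp add: assoc_mult_mat_dim dims del: assoc_mult_mat)
      also have "\<dots> = 0\<^sub>m (pd j) (md i)"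
        unfolding D_def GDG using V[of j] U[of i] by simp
      finally have "?X = 0\<^sub>m (md j) (pd i)"
        using that(3) X \<open>i < N\<close> \<open>j < N\<close> unfolding kernel_iff by blast
      also have "\<dots> = transpose_mat (U j) * 0\<^sub>m mm pp * V i"
        using U[of j] V[of i] by simp
      finally show "transpose_mat (block_embedding N md j) * D * block_embedding N pd i =
          transpose_mat (block_embedding N md j) * 0\<^sub>m (sum md {..<N}) (sum pd {..<N}) * block_embedding N pd i"
        unfolding U_def V_def mm_def pp_def .
    qed (use D in \<open>simp_all add: mm_def pp_def\<close>)
    have "Q' = QQ"
    proof (rule eq_matI)
      fix x y assume "x < dim_row QQ" "y < dim_col QQ"
      then have xy: "x < mm" "y < pp"
        using QQ by auto
      then have "D $$ (x, y) = 0"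
        using \<open>D = 0\<^sub>m mm pp\<close> by simp
      moreover have "D $$ (x, y) = QQ $$ (x, y) - Q' $$ (x, y)"
        unfolding D_def using xy Q' by (intro index_minus_mat) auto
      ultimately show "Q' $$ (x, y) = QQ $$ (x, y)"
        by simp
    qed (use QQ Q' in auto)
    with \<open>Q' \<noteq> QQ\<close> show False ..
  qed
  ultimately show ?thesis
    by blast
qed

end
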